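(* Let $E$ be a finite set, $w\colon E\to\mathbb{R}_{>0}$, $M\geq1$, and $f\colon2^{E}\to\mathbb{R}_{\geq0}$ monotone, $M$-bounded and fractionally subadditive. Then the ordering $\pi^{\mathrm{A}}$ of $E$ produced by the algorithm $\textsc{Alg}_{\mathrm{scale}}$ is $\rho$-competitive for $\rho=\max\{\lambda\sqrt{M},2M\}\approx\max\{3.2924\sqrt{M},2M\}$.
   Context: Notation: $w(S):=\sum_{e\in S}w(e)$; $f^{*}(C):=\max\{f(S):S\subseteq E,w(S)\leq C\}$, and for each $C>0$ an optimal set $S^{*}_{C}$ (with $w(S^{*}_{C})\leq C$, $f(S^{*}_{C})=f^{*}(C)$) is fixed. For an ordering $\pi=(e_{\pi(1)},\dots,e_{\pi(m)})$ of $E$ and $C>0$, $\pi(C)$ is the maximal prefix $\{e_{\pi(1)},\dots,e_{\pi(k)}\}$ with $\sum_{i\le k}w(e_{\pi(i)})\leq C$; $\pi$ is $\rho$-competitive if $f^{*}(C)\leq\rho f(\pi(C))$ for all $C>0$. Monotone: $f(A)\geq f(B)$ for $A\supseteq B$; $M$-bounded: $f(\{e\})\in[1,M]$ for all $e$; fractionally subadditive: $f(A)\leq\sum_{i}\alpha_{i}f(B_{i})$ whenever $\alpha_{i}\geq0$ and $\sum_{i:e\in B_{i}}\alpha_{i}\geq1$ for all $e\in A$. For $X\subseteq E$ let $\gamma^{*}(X)\in\mathbb{R}^{E}$ be an optimal solution of the LP: maximize $\sum_{e\in X}\gamma_{e}$ s.t. $\sum_{e\in B}\gamma_{e}\leq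 f(B)$ for all $B\subseteq E$, $\gamma\geq0$. Constants: $\lambda\approx3.2924$ is the unique real root of $\lambda^{7}-2\lambda^{6}-3\lambda^{5}-3\lambda^{4}-3\lambda^{3}-2\lambda^{2}-\lambda-1=0$, $\delta:=\lambda^{3}/(\lambda^{2}+1)\approx3.0143$, $\rho:=\max\{\lambda\sqrt{M},2M\}$. Algorithm $\textsc{Alg}_{\mathrm{scale}}$: set $C_{1}:=\min_{e\in E}w(e)$; for $i=2,3,\dots$, as long as the set $\{C\in[\delta C_{i-1},w(E)):f^{*}(C)\geq\rho f^{*}(C_{i-1})\}$ is nonempty, let $C_{i}$ be its minimum; if $N-1$ is the last index so defined, set $C_{N}:=w(E)$. In phase $1$ the algorithm appends the element of $S^{*}_{C_{1}}$; in phase $2$ it appends first an element $e$ of $S^{*}_{C_{2}}$ maximizing $f(\{e\})$ and then the other elements of $S^{*}_{C_{2}}$ in arbitrary order; in phase $i\in\{3,\dots,N\}$ it appends the elements of $S^{*}_{C_{i}}$ in an order $(e_{1},\dots,e_{n})$ with $\gamma^{*}_{e_{j}}(S^{*}_{C_{i}})/w(e_{j})\geq\gamma^{*}_{e_{j+1}}(S^{*}_{C_{i}})/w(e_{j+1})$ for all $j<n$. Elements already appended earlier are skipped, and any elements not appended at the end are appended in arbitrary order; the resulting ordering of $E$ is $\pi^{\mathrm{A}}$. *)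

theory Defs
  imports "HOL-Analysis.Analysis"
begin

section \<open>Objective functions\<close>

text \<open>Set functions on the power set of a finite ground set \<open>E\<close> are functions on \<open>'a set\<close> of which
  only the values on subsets of \<open>E\<close> are used.\<close>

definition monotone_obj :: "'a set \<Rightarrow> ('a set \<Rightarrow> real) \<Rightarrow> bool" where
  "monotone_obj E f \<longleftrightarrow> (\<forall>A B. B \<subseteq> A \<and> A \<subseteq> E \<longrightarrow> f B \<le> f A)"

definition bounded_obj :: "real \<Rightarrow> 'a set \<Rightarrow> ('a set \<Rightarrow> real) \<Rightarrow> bool" where
  "bounded_obj M E f \<longleftrightarrow> (\<forall>e\<in>E. f {e} \<in> {1..M})"

definition fractionally_subadditive :: "'a set \<Rightarrow> ('a set \<Rightarrow> real) \<Rightarrow> bool" where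
  "fractionally_subadditive E f \<longleftrightarrow>
     (\<forall>A (n::nat) (B :: nat \<Rightarrow> 'a set) (\<alpha> :: nat \<Rightarrow> real).
        A \<subseteq> E \<and> (\<forall>i<n. B i \<subseteq> E \<and> 0 \<le> \<alpha> i) \<and> (\<forall>e\<in>A. (\<Sum>i\<in>{i. i < n \<and> e \<in> B i}. \<alpha> i) \<ge> 1)
        \<longrightarrow> f A \<le> (\<Sum>i<n. \<alpha> i * f (B i)))"

section \<open>Knapsack optima and competitive orderings\<close>

definition opt_value :: "'a set \<Rightarrow> ('a \<Rightarrow> real) \<Rightarrow> ('a set \<Rightarrow> real) \<Rightarrow> real \<Rightarrow> real" where
  "opt_value E w f C = Max (f ` {S. S \<subseteq> E \<and> sum w S \<le> C})"

definition optimal_set ::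
    "'a set \<Rightarrow> ('a \<Rightarrow> real) \<Rightarrow> ('a set \<Rightarrow> real) \<Rightarrow> real \<Rightarrow> 'a set \<Rightarrow> bool" where
  "optimal_set E w f C S \<longleftrightarrow> S \<subseteq> E \<and> sum w S \<le> C \<and> f S = opt_value E w f C"

definition is_ordering :: "'a set \<Rightarrow> 'a list \<Rightarrow> bool" where
  "is_ordering X xs \<longleftrightarrow> distinct xs \<and> set xs = X"

definition prefix_within :: "('a \<Rightarrow> real) \<Rightarrow> 'a list \<Rightarrow> real \<Rightarrow> 'a set" where
  "prefix_within w xs C =
     set (take (Max {k. k \<le> length xs \<and> (\<Sum>i<k. w (xs ! i)) \<le> C}) xs)"

definition competitive ::
    "'a set \<Rightarrow> ('a \<Rightarrow> real) \<Rightarrow> ('a set \<Rightarrow> real) \<Rightarrow> real \<Rightarrow> 'a list \<Rightarrow> bool" where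
  "competitive E w f r xs \<longleftrightarrow> (\<forall>C>0. opt_value E w f C \<le> r * f (prefix_within w xs C))"

section \<open>The linear program\<close>

definition lp_feasible :: "'a set \<Rightarrow> ('a set \<Rightarrow> real) \<Rightarrow> ('a \<Rightarrow> real) \<Rightarrow> bool" where
  "lp_feasible E f g \<longleftrightarrow> (\<forall>B\<subseteq>E. sum g B \<le> f B) \<and> (\<forall>e\<in>E. 0 \<le> g e)"

definition lp_optimal :: "'a set \<Rightarrow> ('a set \<Rightarrow> real) \<Rightarrow> 'a set \<Rightarrow> ('a \<Rightarrow> real) \<Rightarrow> bool" where
  "lp_optimal E f X g \<longleftrightarrow> lp_feasible E f g \<and> (\<forall>h. lp_feasible E f h \<longrightarrow> sum h X \<le> sum g X)"

section \<open>Constants\<close>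

definition scale_poly :: "real \<Rightarrow> real" where
  "scale_poly x = x^7 - 2 * x^6 - 3 * x^5 - 3 * x^4 - 3 * x^3 - 2 * x^2 - x - 1"

definition scale_lambda :: real where
  "scale_lambda = (THE x. scale_poly x = 0)"

definition scale_delta :: real where
  "scale_delta = scale_lambda ^ 3 / (scale_lambda ^ 2 + 1)"

definition scale_rho :: "real \<Rightarrow> real" where
  "scale_rho M = max (scale_lambda * sqrt M) (2 * M)"

lemma scale_poly_root_pos: "x > 0" if "scale_poly x = 0"
proof (rule ccontr)
  assume "\<not> x > 0"
  define y where "y = - x"
  have y: "y \<ge> 0" "x = - y" using \<open>\<not> x > 0\<close> by (auto simp: y_def)
  have "- scale_poly x = y^5 * (y - 1)^2 + (2 * y^3 - y^2)^2 + 2 * (y * (y - 3/4))^2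
      + 7/8 * (y - 4/7)^2 + 5/7"
    unfolding scale_poly_def y(2) by algebra
  moreover have "\<dots> > 0" using y(1) by (intro add_nonneg_pos add_nonneg_nonneg mult_nonneg_nonneg) auto
  ultimately show False using that by simp
qed

lemma scale_poly_root_unique: "\<not> x < y" if "scale_poly x = 0" "scale_poly y = 0"
proof
  assume "x < y"
  have x: "0 < x" using that(1) by (rule scale_poly_root_pos)
  have le: "x^7 * y^k \<le> x^k * y^7" if "k \<le> 7" for k
  proof -
    have "x^7 * y^k = (x^k * y^k) * x^(7 - k)"
      using that by (simp add: mult_ac flip: power_add)
    also have "\<dots> \<le> (x^k * y^k) * y^(7 - k)"
      using x \<open>x < y\<close> by (intro mult_left_mono power_mono) auto
    also have "\<dots> = x^k * y^7" using that by (simp add: mult_ac flip: power_add)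
    finally show ?thesis .
  qed
  have "x^7 < y^7" using x \<open>x < y\<close> by (intro power_strict_mono) auto
  moreover have "x^7 * (y^7 - scale_poly y) = y^7 * (x^7 - scale_poly x)"
    using that by simp
  ultimately show False
    using le[of 1] le[of 2] le[of 3] le[of 4] le[of 5] le[of 6]
    by (simp add: scale_poly_def algebra_simps)
qed

lemma scale_lambda_root: "scale_poly scale_lambda = 0"
  and scale_lambda_approx: "\<bar>scale_lambda - 3.2924\<bar> \<le> 0.00005"
  and scale_lambda_unique: "scale_poly x = 0 \<Longrightarrow> x = scale_lambda"
proof -
  have "\<exists>x\<ge>3.29235. x \<le> 3.29245 \<and> scale_poly x = 0"
    by (rule IVT') (auto simp: scale_poly_def power_divide intro!: continuous_intros)
  then obtain x0 where x0: "x0 \<ge> 3.29235" "x0 \<le> 3.29245" "scale_poly x0 = 0" by blast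
  have uniq: "y = x0" if "scale_poly y = 0" for y
    using scale_poly_root_unique[OF that x0(3)] scale_poly_root_unique[OF x0(3) that] by simp
  have eq: "scale_lambda = x0"
    unfolding scale_lambda_def using x0(3) uniq by (rule the_equality)
  show "scale_poly scale_lambda = 0" "\<bar>scale_lambda - 3.2924\<bar> \<le> 0.00005"
    using x0 unfolding eq abs_le_iff by auto
  show "x = scale_lambda" if "scale_poly x = 0" using uniq[OF that] by (simp add: eq)
qed

section \<open>The algorithm\<close>

definition next_budgets ::
    "'a set \<Rightarrow> ('a \<Rightarrow> real) \<Rightarrow> ('a set \<Rightarrow> real) \<Rightarrow> real \<Rightarrow> real \<Rightarrow> real set" where
  "next_budgets E w f M c =
     {C \<in> {scale_delta * c..<sum w E}. opt_value E w f C \<ge> scale_rho M * opt_value E w f c}"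

definition scale_budgets ::
    "'a set \<Rightarrow> ('a \<Rightarrow> real) \<Rightarrow> ('a set \<Rightarrow> real) \<Rightarrow> real \<Rightarrow> nat \<Rightarrow> (nat \<Rightarrow> real) \<Rightarrow> bool" where
  "scale_budgets E w f M N C \<longleftrightarrow>
     N \<ge> 2 \<and> C 1 = Min (w ` E) \<and>
     (\<forall>i\<in>{2..<N}. next_budgets E w f M (C (i - 1)) \<noteq> {} \<and>
                   C i = (LEAST c. c \<in> next_budgets E w f M (C (i - 1)))) \<and>
     next_budgets E w f M (C (N - 1)) = {} \<and>
     C N = sum w E"

text \<open>\<open>phase_list w f X g i xs\<close>: phase \<open>i\<close> may process the elements of the set \<open>X\<close> (the optimal set
  for the budget of that phase) in the order \<open>xs\<close>; \<open>g\<close> is the LP solution for \<open>X\<close>. Ties are broken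
  arbitrarily.\<close>

definition phase_list ::
    "('a \<Rightarrow> real) \<Rightarrow> ('a set \<Rightarrow> real) \<Rightarrow> 'a set \<Rightarrow> ('a \<Rightarrow> real) \<Rightarrow> nat \<Rightarrow> 'a list \<Rightarrow> bool" where
  "phase_list w f X g i xs \<longleftrightarrow>
     (if i = 1 then \<exists>e. X = {e} \<and> xs = [e]
      else if i = 2 then is_ordering X xs \<and> (\<exists>e ys. xs = e # ys \<and> (\<forall>x\<in>X. f {x} \<le> f {e}))
      else is_ordering X xs \<and>
           (\<forall>j. Suc j < length xs \<longrightarrow>
              g (xs ! j) / w (xs ! j) \<ge> g (xs ! Suc j) / w (xs ! Suc j)))"

definition append_new :: "'a list \<Rightarrow> 'a list \<Rightarrow> 'a list" where
  "append_new xs ys = xs @ filter (\<lambda>y. y \<notin> set xs) ys"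

text \<open>\<open>alg_scale E w f M S \<gamma> \<pi>\<close>: the ordering \<open>\<pi>\<close> is a possible output of the algorithm, where \<open>S C\<close> is
  the fixed optimal set for budget \<open>C\<close> and \<open>\<gamma> X\<close> the fixed LP solution for \<open>X\<close>. As the first budget
  is the minimum over \<open>E\<close>, the empty ground set is treated separately.\<close>

definition alg_scale ::
    "'a set \<Rightarrow> ('a \<Rightarrow> real) \<Rightarrow> ('a set \<Rightarrow> real) \<Rightarrow> real \<Rightarrow> (real \<Rightarrow> 'a set) \<Rightarrow>
     ('a set \<Rightarrow> 'a \<Rightarrow> real) \<Rightarrow> 'a list \<Rightarrow> bool" where
  "alg_scale E w f M S \<gamma> \<pi> \<longleftrightarrow>
     (if E = {} then \<pi> = [] else
      \<exists>N C xs rest.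
        scale_budgets E w f M N C \<and>
        (\<forall>i\<in>{1..N}. phase_list w f (S (C i)) (\<gamma> (S (C i))) i (xs i)) \<and>
        (let \<sigma> = foldl append_new [] (map xs [1..<Suc N])
         in is_ordering (E - set \<sigma>) rest \<and> \<pi> = \<sigma> @ rest))"

section \<open>The algorithm has an output\<close>

lemma scale_delta_gt_1: "scale_delta > 1"
proof -
  have "scale_lambda \<ge> 3" using scale_lambda_approx unfolding abs_le_iff by simp
  then have "3 * scale_lambda\<^sup>2 \<le> scale_lambda * scale_lambda\<^sup>2" and "3\<^sup>2 \<le> scale_lambda\<^sup>2"
    by (intro mult_right_mono power_mono; simp)+
  then have "scale_lambda\<^sup>2 + 1 < scale_lambda ^ 3" by (simp add: power3_eq_cube power2_eq_square)
  moreover have "scale_lambda\<^sup>2 + 1 > 0" by (simp add: add_nonneg_pos)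
  ultimately show ?thesis by (simp add: scale_delta_def)
qed

lemma opt_value_ge_iff:
  assumes "finite E" "C \<ge> 0"
  shows "t \<le> opt_value E w f C \<longleftrightarrow> (\<exists>S\<subseteq>E. sum w S \<le> C \<and> t \<le> f S)"
proof -
  have "finite (f ` {S. S \<subseteq> E \<and> sum w S \<le> C})" using assms by simp
  moreover have "{} \<in> {S. S \<subseteq> E \<and> sum w S \<le> C}" using assms by simp
  ultimately show ?thesis unfolding opt_value_def by (subst Max_ge_iff) auto
qed

lemma next_budgets_Least:
  assumes "finite E" "c > 0" "next_budgets E w f M c \<noteq> {}"
  shows "(LEAST C. C \<in> next_budgets E w f M c) \<in> next_budgets E w f M c"
proof -
  define t where "t = scale_rho M * opt_value E w f c"
  define W where "W = sum w ` {S. S \<subseteq> E \<and> t \<le> f S}"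
  have W: "finite W" using assms(1) by (simp add: W_def)
  have "scale_delta * c > 0" using scale_delta_gt_1 assms(2) by simp
  then have iff: "C \<in> next_budgets E w f M c \<longleftrightarrow>
      scale_delta * c \<le> C \<and> C < sum w E \<and> (\<exists>v\<in>W. v \<le> C)" for C
  proof (cases "scale_delta * c \<le> C")
    case True
    then have "C \<ge> 0" using \<open>scale_delta * c > 0\<close> by simp
    have "t \<le> opt_value E w f C \<longleftrightarrow> (\<exists>v\<in>W. v \<le> C)"
      unfolding W_def opt_value_ge_iff[OF assms(1) \<open>C \<ge> 0\<close>] by blast
    then show ?thesis by (auto simp: next_budgets_def t_def)
  qed (simp add: next_budgets_def)
  obtain C0 where C0: "C0 \<in> next_budgets E w f M c" using assms(3) by blast
  then have "W \<noteq> {}" using iff by blast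
  define m where "m = max (scale_delta * c) (Min W)"
  have le: "m \<le> C" if "C \<in> next_budgets E w f M c" for C
    using that W by (auto simp: iff m_def intro: order_trans[OF Min_le])
  have mem: "m \<in> next_budgets E w f M c"
    using le[OF C0] C0 Min_in[OF W \<open>W \<noteq> {}\<close>]
    by (auto simp: iff m_def intro!: bexI[of _ "Min W"])
  from mem le have "(LEAST C. C \<in> next_budgets E w f M c) = m" by (rule Least_equality)
  then show ?thesis using mem by simp
qed

lemma scale_budgets_exist:
  assumes "finite E" "E \<noteq> {}" "\<And>e. e \<in> E \<Longrightarrow> w e > 0"
  shows "\<exists>N C. scale_budgets E w f M N C \<and> (\<forall>i\<in>{1..N}. C i > 0)"
proof -
  let ?B = "next_budgets E w f M"
  define g where "g c = (LEAST C. C \<in> ?B c)" for c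
  define D where "D i = (g ^^ i) (Min (w ` E))" for i
  have D0: "D 0 > 0" using assms by (simp add: D_def)
  have DSuc: "D (Suc i) = g (D i)" for i by (simp add: D_def)
  have grow: "D i \<ge> scale_delta ^ i * D 0" if "\<forall>j<i. ?B (D j) \<noteq> {}" for i
    using that
  proof (induction i)
    case (Suc i)
    then have IH: "scale_delta ^ i * D 0 \<le> D i" by simp
    then have "D i > 0"
      using D0 scale_delta_gt_1 by (intro less_le_trans[OF _ IH] mult_pos_pos zero_less_power) auto
    then have "D (Suc i) \<in> ?B (D i)"
      using next_budgets_Least[OF assms(1)] Suc.prems by (simp add: DSuc g_def)
    then have "scale_delta * D i \<le> D (Suc i)" by (simp add: next_budgets_def)
    moreover have "scale_delta * (scale_delta ^ i * D 0) \<le> scale_delta * D i"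
      using IH scale_delta_gt_1 by (intro mult_left_mono) auto
    ultimately show ?case by simp
  qed simp
  have pos: "D i > 0" if "\<forall>j<i. ?B (D j) \<noteq> {}" for i
    using D0 scale_delta_gt_1 by (intro less_le_trans[OF _ grow[OF that]] mult_pos_pos zero_less_power) auto
  have "\<exists>i. ?B (D i) = {}"
  proof (rule ccontr)
    assume *: "\<nexists>i. ?B (D i) = {}"
    obtain n where "sum w E / D 0 < scale_delta ^ n"
      using real_arch_pow[OF scale_delta_gt_1] by blast
    then have "sum w E < D n" using grow[of n] * D0 by (simp add: field_simps)
    moreover obtain C where "C \<in> ?B (D n)" using * by blast
    moreover have "D n \<le> scale_delta * D n" using pos[of n] * scale_delta_gt_1 by simp
    ultimately show False by (simp add: next_budgets_def)
  qed
  then obtain n where n: "?B (D n) = {}" "\<forall>j<n. ?B (D j) \<noteq> {}"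
    using exists_least_iff[of "\<lambda>i. ?B (D i) = {}"] by blast
  define C where "C i = (if i = n + 2 then sum w E else D (i - 1))" for i
  have "scale_budgets E w f M (n + 2) C"
    unfolding scale_budgets_def
  proof (intro conjI ballI)
    fix i assume i: "i \<in> {2..<n + 2}"
    then have j: "i = Suc (Suc (i - 2))" "i - 2 < n" by auto
    then obtain j where j: "i = Suc (Suc j)" "j < n" by blast
    show "?B (C (i - 1)) \<noteq> {}" "C i = (LEAST c. c \<in> ?B (C (i - 1)))"
      using n j by (auto simp: C_def DSuc g_def)
  qed (use n in \<open>auto simp: C_def D_def\<close>)
  moreover have "C i > 0" if "i \<in> {1..n + 2}" for i
    using that n pos[of "i - 1"] assms by (auto simp: C_def intro!: sum_pos)
  ultimately show ?thesis by blast
qed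

lemma fractionally_subadditive_empty: "fractionally_subadditive E f \<Longrightarrow> f {} \<le> 0"
  unfolding fractionally_subadditive_def by (drule spec[of _ "{}"], drule spec[of _ 0]) auto

lemma phase_list_exists:
  assumes "finite X" "i \<le> 2 \<Longrightarrow> X \<noteq> {}" "i = 1 \<Longrightarrow> \<exists>e. X = {e}"
  shows "\<exists>xs. phase_list w f X g i xs"
proof -
  obtain zs where zs: "is_ordering X zs" using finite_distinct_list[OF assms(1)] by (auto simp: is_ordering_def)
  consider "i = 1" | "i = 2" | "i \<noteq> 1" "i \<noteq> 2" by blast
  then show ?thesis
  proof cases
    case 1
    then show ?thesis using assms(3) by (auto simp: phase_list_def)
  next
    case 2
    have "Max ((\<lambda>x. f {x}) ` X) \<in> (\<lambda>x. f {x}) ` X" using assms 2 by (intro Max_in) auto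
    then obtain e where "e \<in> X" and e: "f {e} = Max ((\<lambda>x. f {x}) ` X)" by auto
    have "\<forall>x\<in>X. f {x} \<le> f {e}" using assms(1) by (simp add: e)
    moreover have "is_ordering X (e # remove1 e zs)"
      using zs \<open>e \<in> X\<close> by (auto simp: is_ordering_def)
    ultimately show ?thesis using 2 by (auto simp: phase_list_def)
  next
    case 3
    define xs where "xs = sort_key (\<lambda>x. - (g x / w x)) zs"
    have "is_ordering X xs" using zs by (simp add: xs_def is_ordering_def)
    moreover have "sorted (map (\<lambda>x. - (g x / w x)) xs)" by (simp add: xs_def)
    then have "g (xs ! j) / w (xs ! j) \<ge> g (xs ! Suc j) / w (xs ! Suc j)" if "Suc j < length xs" for j
      using sorted_nth_mono[of "map (\<lambda>x. - (g x / w x)) xs" j "Suc j"] that by simp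
    ultimately show ?thesis using 3 by (auto simp: phase_list_def)
  qed
qed

lemma alg_scale_exists:
  assumes "finite E" "\<And>e. e \<in> E \<Longrightarrow> w e > 0"
    and "bounded_obj M E f" "fractionally_subadditive E f"
    and opt: "\<And>C. C > 0 \<Longrightarrow> optimal_set E w f C (S C)"
  shows "\<exists>\<pi>. alg_scale E w f M S \<gamma> \<pi>"
proof (cases "E = {}")
  case False
  obtain N C where C: "scale_budgets E w f M N C" "\<forall>i\<in>{1..N}. C i > 0"
    using scale_budgets_exist[of E w f M] assms(1,2) False by blast
  have N: "N \<ge> 2" and C1: "C 1 = Min (w ` E)" using C(1) by (auto simp: scale_budgets_def)
  have ne: "S c \<noteq> {}" if "c \<ge> C 1" for c
  proof -
    obtain e where e: "e \<in> E" "w e = C 1"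
      using Min_in[of "w ` E"] assms(1) False C1 by (metis finite_imageI image_iff image_is_empty)
    have "C 1 > 0" using C(2) N by simp
    then have "c > 0" using that by simp
    have "f {e} \<le> opt_value E w f c"
      using opt_value_ge_iff[OF assms(1), of c "f {e}" w f] \<open>c > 0\<close> e that by force
    moreover have "f {e} \<ge> 1" using assms(3) e by (simp add: bounded_obj_def)
    ultimately show ?thesis
      using opt[OF \<open>c > 0\<close>] fractionally_subadditive_empty[OF assms(4)] by (auto simp: optimal_set_def)
  qed
  have single: "\<exists>e. S (C 1) = {e}"
  proof -
    have o: "S (C 1) \<subseteq> E" "sum w (S (C 1)) \<le> C 1"
      using opt[of "C 1"] C(2) N by (auto simp: optimal_set_def)
    obtain e where e: "e \<in> S (C 1)" using ne by blast
    have "x = e" if "x \<in> S (C 1)" for x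
    proof (rule ccontr)
      assume "x \<noteq> e"
      then have "w x + w e = sum w {x, e}" by simp
      also have "\<dots> \<le> sum w (S (C 1))"
        using that e o assms(1,2) by (intro sum_mono2) (auto intro: finite_subset less_imp_le)
      finally have "w x + w e \<le> Min (w ` E)" using o C1 by simp
      moreover have "Min (w ` E) \<le> w e" using e o assms(1) by auto
      ultimately show False using assms(2)[of x] that o by auto
    qed
    then show ?thesis using e by blast
  qed
  have "C 2 \<ge> C 1"
  proof (cases "N = 2")
    case True
    obtain e where e: "e \<in> E" using False by blast
    have "Min (w ` E) \<le> w e" using e assms(1) by simp
    also have "\<dots> \<le> sum w E" using e assms(1,2) by (intro member_le_sum) (auto intro: less_imp_le)
    finally show ?thesis using C(1) True by (simp add: scale_budgets_def)
  next
    case False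
    have p: "C 1 > 0" using C(2) N by simp
    have "2 \<in> {2..<N}" using N False by simp
    then have *: "next_budgets E w f M (C (2 - 1)) \<noteq> {}"
        "C 2 = (LEAST c. c \<in> next_budgets E w f M (C (2 - 1)))"
      using C(1) unfolding scale_budgets_def by blast+
    have "C 2 \<in> next_budgets E w f M (C 1)"
      using * next_budgets_Least[OF assms(1) p, of w f M] by simp
    then have "scale_delta * C 1 \<le> C 2" by (simp add: next_budgets_def)
    moreover have "C 1 \<le> scale_delta * C 1" using p scale_delta_gt_1 by simp
    ultimately show ?thesis by simp
  qed
  have "\<exists>xs. phase_list w f (S (C i)) (\<gamma> (S (C i))) i xs" if "i \<in> {1..N}" for i
  proof (rule phase_list_exists)
    show "finite (S (C i))"
      using opt C(2) that assms(1) by (meson finite_subset optimal_set_def)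
    show "S (C i) \<noteq> {}" if "i \<le> 2"
    proof -
      have "i = 1 \<or> i = 2" using that \<open>i \<in> {1..N}\<close> by auto
      then show ?thesis using ne \<open>C 2 \<ge> C 1\<close> by auto
    qed
  qed (use single in auto)
  then obtain xs where xs: "\<forall>i\<in>{1..N}. phase_list w f (S (C i)) (\<gamma> (S (C i))) i (xs i)" by metis
  define \<sigma> where "\<sigma> = foldl append_new [] (map xs [1..<Suc N])"
  obtain rest where "is_ordering (E - set \<sigma>) rest"
    using finite_distinct_list[of "E - set \<sigma>"] assms(1) by (auto simp: is_ordering_def)
  then have "alg_scale E w f M S \<gamma> (\<sigma> @ rest)"
    using C(1) xs False unfolding alg_scale_def Let_def \<sigma>_def by (simp only: if_False) blast
  then show ?thesis by blast
qed (simp add: alg_scale_def)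

end

theory Submission
  imports Defs
begin

text \<open>By LP duality, fractional subadditivity makes the optimal LP solution \<open>g\<close> for \<open>X\<close> attain
  \<open>sum g X = f X\<close>, while \<open>g e \<le> f {e} \<le> M\<close>. Hence a prefix of \<open>X\<close> in order of decreasing density
  with capacity \<open>c \<le> d\<close>, where \<open>d\<close> bounds the weight of \<open>X\<close>, has value at least \<open>c / d * f X - M\<close>.
  This gives both the growth bound \<open>opt d \<le> d / c * (opt c + M)\<close> and a lower bound for the value
  reached in the middle of a phase. Let \<open>C i \<le> c < C (i + 1)\<close>. By minimality of \<open>C (i + 1)\<close>, the
  optimum for \<open>c\<close> can exceed \<open>\<rho> * opt (C i)\<close> only if \<open>c < \<delta> * C i\<close>. For \<open>i \<ge> 3\<close> the optimum
  \<open>opt (C i) \<ge> \<rho>\<^sup>2 \<ge> \<lambda>\<^sup>2 * M\<close> is so large that the additive loss \<open>M\<close> is absorbed, because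
  \<open>\<delta> * (1 + 1 / \<lambda>\<^sup>2) = \<lambda>\<close>. For \<open>i \<le> 2\<close> the elements of the next phase already in the prefix
  have to be taken into account: for \<open>i = 2\<close> this leads to the equation defining \<open>\<lambda>\<close>, and for
  \<open>i = 1\<close> at most three elements matter.\<close>

section \<open>Linear inequalities\<close>

text \<open>A pair \<open>(a, b)\<close> stands for the inequality
  \<open>(\<Sum>e. a e * x e) \<le> b\<close> in the unknowns \<open>x\<close>, so the cone holds
  the nonnegative combinations of the constraints in \<open>K\<close>. Generating it inductively
  allows rule induction in place of explicit multipliers.\<close>

inductive_set constraint_cone :: "(('a \<Rightarrow> real) \<times> real) set \<Rightarrow> (('a \<Rightarrow> real) \<times> real) set"
  for K where
  zero: "((\<lambda>_. 0), 0) \<in> constraint_cone K"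
| base: "k \<in> K \<Longrightarrow> k \<in> constraint_cone K"
| add: "(a, b) \<in> constraint_cone K \<Longrightarrow> (a', b') \<in> constraint_cone K \<Longrightarrow>
    ((\<lambda>e. a e + a' e), b + b') \<in> constraint_cone K"
| scale: "(a, b) \<in> constraint_cone K \<Longrightarrow> c \<ge> 0 \<Longrightarrow>
    ((\<lambda>e. c * a e), c * b) \<in> constraint_cone K"

lemma constraint_cone_subset:
  assumes "K' \<subseteq> constraint_cone K"
  shows "constraint_cone K' \<subseteq> constraint_cone K"
proof
  fix k assume "k \<in> constraint_cone K'"
  then show "k \<in> constraint_cone K"
    by induction (use assms in \<open>auto intro: constraint_cone.intros\<close>)
qed

lemma between_finite:
  fixes L U :: "real set"
  assumes "finite L" "finite U" "\<And>l u. l \<in> L \<Longrightarrow> u \<in> U \<Longrightarrow> l \<le> u"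
  shows "\<exists>t. (\<forall>l\<in>L. l \<le> t) \<and> (\<forall>u\<in>U. t \<le> u)"
proof (cases "L = {}")
  case True
  then show ?thesis using Min_le[OF assms(2)] by blast
next
  case False
  then show ?thesis using assms Max_ge[OF assms(1)] Max_in[OF assms(1)] by blast
qed

text \<open>Fourier-Motzkin elimination, by induction on the variables. To remove \<open>e\<close>,
  every constraint with positive coefficient at \<open>e\<close> is added to every one with negative
  coefficient, both scaled so that \<open>e\<close> cancels. A refutation of the reduced system also
  refutes the original one, and a solution extends to \<open>e\<close> because every lower bound for
  the new value lies below every upper bound.\<close>

lemma farkas:
  fixes K :: "(('a \<Rightarrow> real) \<times> real) set"
  assumes "finite F" "finite K"
  shows "(\<exists>x. \<forall>(a, b)\<in>K. (\<Sum>e\<in>F. a e * x e) \<le> b) \<or>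
         (\<exists>(a, b)\<in>constraint_cone K. (\<forall>e\<in>F. a e = 0) \<and> b < 0)"
  using assms
proof (induction F arbitrary: K)
  case empty
  show ?case
  proof (cases "\<forall>(a, b)\<in>K. b \<ge> 0")
    case False
    then obtain a b where "(a, b) \<in> K" "b < 0" by force
    then show ?thesis by (auto intro: constraint_cone.base)
  qed simp
next
  case (insert e F)
  define P where "P = {k\<in>K. fst k e > 0}"
  define Q where "Q = {k\<in>K. fst k e < 0}"
  define Z where "Z = {k\<in>K. fst k e = 0}"
  define comb :: "('a \<Rightarrow> real) \<times> real \<Rightarrow> ('a \<Rightarrow> real) \<times> real \<Rightarrow> ('a \<Rightarrow> real) \<times> real" where
    "comb p q = ((\<lambda>x. 1 / fst p e * fst p x + (- 1 / fst q e) * fst q x),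
       1 / fst p e * snd p + (- 1 / fst q e) * snd q)" for p q
  define K' where "K' = Z \<union> (\<lambda>(p, q). comb p q) ` (P \<times> Q)"
  have fin: "finite P" "finite Q" "finite Z" using insert.prems by (auto simp: P_def Q_def Z_def)
  then have "finite K'" by (simp add: K'_def)
  have cone: "K' \<subseteq> constraint_cone K"
  proof
    fix k assume "k \<in> K'"
    then consider "k \<in> Z" | p q where "p \<in> P" "q \<in> Q" "k = comb p q" by (auto simp: K'_def)
    then show "k \<in> constraint_cone K"
    proof cases
      case 1
      then show ?thesis by (auto simp: Z_def intro: constraint_cone.base)
    next
      case 2
      have "(fst p, snd p) \<in> constraint_cone K" "(fst q, snd q) \<in> constraint_cone K"
        using 2 by (auto simp: P_def Q_def intro: constraint_cone.base)
      moreover have "1 / fst p e \<ge> 0" "- 1 / fst q e \<ge> 0"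
        using 2 by (auto simp: P_def Q_def divide_nonpos_neg)
      ultimately show ?thesis unfolding 2(3) comb_def
        by (intro constraint_cone.add constraint_cone.scale) auto
    qed
  qed
  \<comment> \<open>This makes a refutation over \<open>F\<close> a refutation over
    \<open>insert e F\<close>.\<close>
  have zero: "fst k e = 0" if "k \<in> constraint_cone K'" for k
    using that by induction (auto simp: K'_def Z_def comb_def P_def Q_def)
  from insert.IH[OF \<open>finite K'\<close>] show ?case
  proof (elim disjE exE)
    assume "\<exists>(a, b)\<in>constraint_cone K'. (\<forall>e\<in>F. a e = 0) \<and> b < 0"
    then obtain a b where ab: "(a, b) \<in> constraint_cone K'" "\<forall>e\<in>F. a e = 0" "b < 0" by blast
    then have "(a, b) \<in> constraint_cone K" using constraint_cone_subset[OF cone] by blast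
    then show ?thesis using ab zero[OF ab(1)] by auto
  next
    fix x assume x: "\<forall>(a, b)\<in>K'. (\<Sum>e\<in>F. a e * x e) \<le> b"
    \<comment> \<open>The bound that \<open>k\<close> puts on the value at \<open>e\<close> once
      \<open>x\<close> is fixed on \<open>F\<close>: an upper bound for \<open>k\<close> in
      \<open>P\<close>, a lower bound for \<open>k\<close> in \<open>Q\<close>, where the divisor is
      negative.\<close>
    define r where "r k = (snd k - (\<Sum>e\<in>F. fst k e * x e)) / fst k e" for k
    have "r q \<le> r p" if "p \<in> P" "q \<in> Q" for p q
    proof -
      have "comb p q \<in> K'" using that by (auto simp: K'_def)
      then have "(\<Sum>y\<in>F. fst (comb p q) y * x y) \<le> snd (comb p q)"
        using x by (auto simp: case_prod_beta)
      moreover have "(\<Sum>y\<in>F. fst (comb p q) y * x y) =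
          1 / fst p e * (\<Sum>y\<in>F. fst p y * x y) + (- 1 / fst q e) * (\<Sum>y\<in>F. fst q y * x y)"
        unfolding sum_distrib_left sum.distrib[symmetric] comb_def
        by (intro sum.cong) (auto simp: algebra_simps)
      ultimately show ?thesis
        by (simp add: comb_def r_def diff_divide_distrib)
    qed
    then obtain t where t: "\<forall>q\<in>Q. r q \<le> t" "\<forall>p\<in>P. t \<le> r p"
      using between_finite[of "r ` Q" "r ` P"] fin by (metis (no_types, lifting) finite_imageI imageE imageI)
    have "(\<Sum>y\<in>insert e F. fst k y * (x(e := t)) y) \<le> snd k" if k: "k \<in> K" for k
    proof -
      have "(\<Sum>y\<in>F. fst k y * (x(e := t)) y) = (\<Sum>y\<in>F. fst k y * x y)"
        using insert.hyps by (intro sum.cong) auto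
      then have eq: "(\<Sum>y\<in>insert e F. fst k y * (x(e := t)) y) =
          fst k e * t + (\<Sum>y\<in>F. fst k y * x y)"
        using insert.hyps by simp
      consider "fst k e = 0" | "fst k e > 0" | "fst k e < 0" by linarith
      then show ?thesis
      proof cases
        case 1
        then have "k \<in> K'" using k by (simp add: K'_def Z_def)
        then show ?thesis using x 1 unfolding eq by (auto simp: case_prod_beta)
      next
        case 2
        then have "t \<le> r k" using t(2) k unfolding P_def by blast
        then show ?thesis using 2 unfolding eq by (simp add: r_def field_simps)
      next
        case 3
        then have "r k \<le> t" using t(1) k unfolding Q_def by blast
        then show ?thesis using 3 unfolding eq by (simp add: r_def field_simps)
      qed
    qed
    then show ?thesis by (intro disjI1 exI[of _ "x(e := t)"]) (auto simp: case_prod_beta)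
  qed
qed

section \<open>Fractional covers and strong duality\<close>

lemma fractionally_subadditiveD:
  assumes "finite E" "fractionally_subadditive E f" "A \<subseteq> E"
    and "\<And>B. B \<subseteq> E \<Longrightarrow> \<alpha> B \<ge> 0" "\<And>e. e \<in> A \<Longrightarrow> (\<Sum>B | B \<subseteq> E \<and> e \<in> B. \<alpha> B) \<ge> 1"
  shows "f A \<le> (\<Sum>B\<in>Pow E. \<alpha> B * f B)"
proof -
  \<comment> \<open>The definition indexes a cover by an initial segment of the naturals.
    Enumerating \<open>Pow E\<close> turns it into weights on subsets, the form in which LP duality
    delivers covers.\<close>
  obtain h where h: "bij_betw h {0..<card (Pow E)} (Pow E)"
    using ex_bij_betw_nat_finite[of "Pow E"] assms(1) by auto
  define n where "n = card (Pow E)"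
  have h: "bij_betw h {..<n} (Pow E)" using h by (simp add: n_def atLeast0LessThan)
  have "f A \<le> (\<Sum>i<n. \<alpha> (h i) * f (h i))"
  proof (rule assms(2)[unfolded fractionally_subadditive_def, rule_format], intro conjI allI impI ballI)
    fix i assume "i < n"
    then have "h i \<in> Pow E" using h by (auto dest: bij_betwE)
    then show "h i \<subseteq> E" "0 \<le> \<alpha> (h i)" using assms(4) by auto
  next
    fix e assume e: "e \<in> A"
    have "h ` {i. i < n \<and> e \<in> h i} = {B \<in> h ` {..<n}. e \<in> B}" by auto
    then have "bij_betw h {i. i < n \<and> e \<in> h i} {B. B \<subseteq> E \<and> e \<in> B}"
      using h by (auto simp: bij_betw_def inj_on_def)
    then have "(\<Sum>i\<in>{i. i < n \<and> e \<in> h i}. \<alpha> (h i)) = (\<Sum>B | B \<subseteq> E \<and> e \<in> B. \<alpha> B)"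
      by (rule sum.reindex_bij_betw)
    then show "1 \<le> (\<Sum>i\<in>{i. i < n \<and> e \<in> h i}. \<alpha> (h i))" using assms(5)[OF e] by simp
  qed (rule assms(3))
  also have "\<dots> = (\<Sum>B\<in>Pow E. \<alpha> B * f B)" using h by (rule sum.reindex_bij_betw)
  finally show ?thesis .
qed

lemma sum_indicator_subset:
  assumes "finite A" "B \<subseteq> A"
  shows "(\<Sum>x\<in>A. indicator B x * h x) = (sum h B :: real)"
  using assms by (intro sum.mono_neutral_cong_right) (auto simp: indicator_def)

text \<open>Strong duality from \<open>farkas\<close>, applied to feasibility together with the
  demand that the value on \<open>X\<close> be at least \<open>f X\<close>. In a refutation, \<nu>
  is the multiplier of that demand and \<alpha> gives the multipliers of the packing constraints;
  those of the nonnegativity constraints leave only the inequality in \<open>R\<close>. Dividing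
  \<alpha> by \<nu> gives a fractional cover of \<open>X\<close> cheaper than \<open>f X\<close>,
  against fractional subadditivity.\<close>

lemma lp_optimal_sum:
  assumes "finite E" "\<And>A. A \<subseteq> E \<Longrightarrow> f A \<ge> 0" "fractionally_subadditive E f" "X \<subseteq> E"
    and "lp_optimal E f X g"
  shows "sum g X = f X"
proof (rule antisym)
  show "sum g X \<le> f X" using assms(4,5) by (auto simp: lp_optimal_def lp_feasible_def)
  define KB where "KB = (\<lambda>B. (indicator B :: 'a \<Rightarrow> real, f B)) ` Pow E"
  define KE where "KE = (\<lambda>e. ((\<lambda>x. - indicator {e} x) :: 'a \<Rightarrow> real, 0 :: real)) ` E"
  define K where "K = insert ((\<lambda>x. - indicator X x), - f X) (KB \<union> KE)"
  have sub: "{B. B \<subseteq> E \<and> e \<in> B} = Pow E \<inter> {B. e \<in> B}" for e by auto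
  \<comment> \<open>A cone element that refutes the system is a fractional cover of \<open>X\<close> of value below \<open>f X\<close>.\<close>
  define R where "R k \<nu> \<alpha> \<longleftrightarrow> \<nu> \<ge> 0 \<and> (\<forall>B\<in>Pow E. \<alpha> B \<ge> 0) \<and>
      (\<forall>e\<in>E. fst k e + \<nu> * indicator X e \<le> (\<Sum>B\<in>Pow E. \<alpha> B * indicator B e)) \<and>
      snd k = (\<Sum>B\<in>Pow E. \<alpha> B * f B) - \<nu> * f X" for k \<nu> \<alpha>
  have *: "\<exists>\<nu> \<alpha>. R k \<nu> \<alpha>" if "k \<in> constraint_cone K" for k
    using that
  proof induction
    case zero
    have "R ((\<lambda>_. 0), 0) 0 (\<lambda>_. 0)" by (simp add: R_def)
    then show ?case by blast
  next
    case (base k)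
    then consider "k = ((\<lambda>x. - indicator X x), - f X)" | B where "B \<in> Pow E" "k = (indicator B, f B)"
      | e where "e \<in> E" "k = ((\<lambda>x. - indicator {e} x), 0)"
      by (auto simp: K_def KB_def KE_def)
    then show ?case
    proof cases
      case 1
      then have "R k 1 (\<lambda>_. 0)" by (simp add: R_def)
      then show ?thesis by blast
    next
      case 2
      have "(\<Sum>B'\<in>Pow E. indicator {B} B' * h B') = h B" for h :: "'a set \<Rightarrow> real"
        using sum_indicator_subset[of "Pow E" "{B}" h] 2 assms(1) by simp
      then have "R k 0 (indicator {B})" using 2 by (simp add: R_def)
      then show ?thesis by blast
    next
      case 3
      then have "R k 0 (\<lambda>_. 0)" by (simp add: R_def)
      then show ?thesis by blast
    qed
  next
    case (add a b a' b')
    from add.IH obtain \<nu> \<alpha> where R1: "R (a, b) \<nu> \<alpha>" by blast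
    from add.IH obtain \<nu>' \<alpha>' where R2: "R (a', b') \<nu>' \<alpha>'" by blast
    have "a e + a' e + (\<nu> + \<nu>') * indicator X e \<le> (\<Sum>B\<in>Pow E. (\<alpha> B + \<alpha>' B) * indicator B e)"
      if "e \<in> E" for e
    proof -
      have "a e + \<nu> * indicator X e \<le> (\<Sum>B\<in>Pow E. \<alpha> B * indicator B e)"
        "a' e + \<nu>' * indicator X e \<le> (\<Sum>B\<in>Pow E. \<alpha>' B * indicator B e)"
        using R1 R2 that by (auto simp: R_def)
      then show ?thesis by (simp add: distrib_right sum.distrib)
    qed
    moreover have "b + b' = (\<Sum>B\<in>Pow E. (\<alpha> B + \<alpha>' B) * f B) - (\<nu> + \<nu>') * f X"
      using R1 R2 by (simp add: R_def distrib_right sum.distrib)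
    ultimately have "R ((\<lambda>e. a e + a' e), b + b') (\<nu> + \<nu>') (\<lambda>B. \<alpha> B + \<alpha>' B)"
      using R1 R2 by (simp add: R_def)
    then show ?case by blast
  next
    case (scale a b c)
    then obtain \<nu> \<alpha> where R1: "R (a, b) \<nu> \<alpha>" by blast
    have "c * a e + c * \<nu> * indicator X e \<le> (\<Sum>B\<in>Pow E. c * \<alpha> B * indicator B e)" if "e \<in> E" for e
    proof -
      have "c * (a e + \<nu> * indicator X e) \<le> c * (\<Sum>B\<in>Pow E. \<alpha> B * indicator B e)"
        using R1 that scale by (intro mult_left_mono) (auto simp: R_def)
      then show ?thesis by (simp add: sum_distrib_left algebra_simps)
    qed
    moreover have "c * b = (\<Sum>B\<in>Pow E. c * \<alpha> B * f B) - c * \<nu> * f X"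
      using R1 by (simp add: R_def sum_distrib_left right_diff_distrib mult.assoc)
    ultimately have "R ((\<lambda>e. c * a e), c * b) (c * \<nu>) (\<lambda>B. c * \<alpha> B)"
      using R1 scale by (simp add: R_def)
    then show ?case by blast
  qed
  have "finite K" using assms(1) by (simp add: K_def KB_def KE_def)
  from farkas[OF assms(1) this] show "f X \<le> sum g X"
  proof (elim disjE exE bexE)
    fix h assume h: "\<forall>(a, b)\<in>K. (\<Sum>e\<in>E. a e * h e) \<le> b"
    have ind: "(\<Sum>e\<in>E. indicator B e * h e) = sum h B" if "B \<subseteq> E" for B
      using assms(1) that by (rule sum_indicator_subset)
    have "sum h B \<le> f B" if "B \<subseteq> E" for B
    proof -
      have "(indicator B, f B) \<in> K" using that by (auto simp: K_def KB_def)
      then show ?thesis using h ind[OF that] by auto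
    qed
    moreover have "h e \<ge> 0" if "e \<in> E" for e
    proof -
      have "((\<lambda>x. - indicator {e} x), 0) \<in> K" using that by (auto simp: K_def KE_def)
      then have "(\<Sum>x\<in>E. - indicator {e} x * h x) \<le> 0" using h by auto
      then show ?thesis using ind[of "{e}"] that by (simp add: sum_negf)
    qed
    ultimately have "lp_feasible E f h" by (auto simp: lp_feasible_def)
    then have "sum h X \<le> sum g X" using assms(5) by (auto simp: lp_optimal_def)
    moreover have "(\<Sum>x\<in>E. - indicator X x * h x) \<le> - f X" using h by (auto simp: K_def)
    then have "f X \<le> sum h X" using ind[OF assms(4)] by (simp add: sum_negf)
    ultimately show ?thesis by simp
  next
    fix k assume k: "k \<in> constraint_cone K" "case k of (a, b) \<Rightarrow> (\<forall>e\<in>E. a e = 0) \<and> b < 0"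
    from *[OF k(1)] obtain \<nu> \<alpha> where "R k \<nu> \<alpha>" by blast
    then have R: "\<nu> \<ge> 0" "\<And>B. B \<subseteq> E \<Longrightarrow> \<alpha> B \<ge> 0" "snd k = (\<Sum>B\<in>Pow E. \<alpha> B * f B) - \<nu> * f X"
      "\<And>e. e \<in> E \<Longrightarrow> fst k e + \<nu> * indicator X e \<le> (\<Sum>B\<in>Pow E. \<alpha> B * indicator B e)"
      by (auto simp: R_def)
    have neg: "(\<Sum>B\<in>Pow E. \<alpha> B * f B) < \<nu> * f X" using R k(2) by auto
    moreover have "(\<Sum>B\<in>Pow E. \<alpha> B * f B) \<ge> 0" using R assms(2) by (intro sum_nonneg) auto
    \<comment> \<open>With \<nu> = 0 the nonnegative cover value would be negative.\<close>
    ultimately have "\<nu> > 0" using R by (cases "\<nu> = 0") auto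
    have "f X \<le> (\<Sum>B\<in>Pow E. \<alpha> B / \<nu> * f B)"
    proof (rule fractionally_subadditiveD[OF assms(1,3,4)])
      fix e assume e: "e \<in> X"
      then have "\<nu> \<le> (\<Sum>B\<in>Pow E. \<alpha> B * indicator B e)" using R(4)[of e] k(2) assms(4) by auto
      also have "\<dots> = (\<Sum>B | B \<subseteq> E \<and> e \<in> B. \<alpha> B)"
        unfolding sub using assms(1) by (simp add: indicator_def if_distrib cong: if_cong)
      finally show "1 \<le> (\<Sum>B | B \<subseteq> E \<and> e \<in> B. \<alpha> B / \<nu>)"
        using \<open>\<nu> > 0\<close> by (simp flip: sum_divide_distrib)
    qed (use R \<open>\<nu> > 0\<close> in auto)
    then have "f X \<le> (\<Sum>B\<in>Pow E. \<alpha> B * f B) / \<nu>" by (simp add: sum_divide_distrib)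
    then show ?thesis using neg \<open>\<nu> > 0\<close> by (simp add: field_simps)
  qed
qed

section \<open>Greedy prefixes\<close>

text \<open>Every element of the prefix is at least as dense as every later one. Summing the
  cross-multiplied inequalities over all such pairs and adding the product of the two prefix sums to
  both sides gives the claim without dividing by a possibly empty weight.\<close>

lemma density_prefix:
  assumes "distinct xs" "\<And>x. x \<in> set xs \<Longrightarrow> w x > (0::real)"
    and "\<And>j. Suc j < length xs \<Longrightarrow> g (xs ! j) / w (xs ! j) \<ge> (g (xs ! Suc j) :: real) / w (xs ! Suc j)"
  shows "sum w (set (take k xs)) * sum g (set xs) \<le> sum g (set (take k xs)) * sum w (set xs)"
proof -
  define P Q where "P = set (take k xs)" and "Q = set (drop k xs)"
  have set: "set xs = P \<union> Q" unfolding P_def Q_def by (metis append_take_drop_id set_append)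
  have disj: "P \<inter> Q = {}" unfolding P_def Q_def
    using assms(1) by (metis append_take_drop_id distinct_append)
  have fin: "finite P" "finite Q" by (auto simp: P_def Q_def)
  have mono: "g (xs ! i) / w (xs ! i) \<ge> g (xs ! j) / w (xs ! j)" if "i \<le> j" "j < length xs" for i j
    using that
  proof (induction j)
    case (Suc j)
    then show ?case using assms(3)[of j] by (cases "i = Suc j") auto
  qed simp
  have le: "w p * g q \<le> g p * w q" if pq: "p \<in> P" "q \<in> Q" for p q
  proof -
    obtain i where i: "p = xs ! i" "i < k" "i < length xs"
      using pq(1) unfolding P_def in_set_conv_nth by auto
    obtain j where j: "q = xs ! (k + j)" "k + j < length xs"
      using pq(2) unfolding Q_def in_set_conv_nth by auto
    have "g q / w q \<le> g p / w p" using mono[of i "k + j"] i j by simp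
    moreover have "w p > 0" "w q > 0" using assms(2) pq set by auto
    ultimately show ?thesis by (simp add: field_simps)
  qed
  have "sum w P * sum g Q \<le> sum g P * sum w Q"
    unfolding sum_product by (intro sum_mono le)
  then show ?thesis
    using disj fin unfolding P_def[symmetric] set by (simp add: sum.union_disjoint algebra_simps)
qed

text \<open>If the list does not fit as a whole, the shortest prefix heavier than \<open>c\<close>
  has at least the share \<open>c / d\<close> of the total value by \<open>density_prefix\<close>.
  Dropping its last element makes it fit and costs at most \<open>M\<close>.\<close>

lemma greedy_prefix:
  assumes "distinct xs" "\<And>x. x \<in> set xs \<Longrightarrow> w x > (0::real)"
    and "\<And>j. Suc j < length xs \<Longrightarrow> g (xs ! j) / w (xs ! j) \<ge> (g (xs ! Suc j) :: real) / w (xs ! Suc j)"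
    and "\<And>x. x \<in> set xs \<Longrightarrow> 0 \<le> g x \<and> g x \<le> M" "M \<ge> 0"
    and "sum w (set xs) \<le> d" "0 \<le> c" "c \<le> d" "0 < d"
  shows "\<exists>k. sum w (set (take k xs)) \<le> c \<and> c / d * sum g (set xs) - M \<le> sum g (set (take k xs))"
proof (cases "sum w (set xs) \<le> c")
  case True
  have g0: "sum g (set xs) \<ge> 0" using assms(4) by (intro sum_nonneg) auto
  have "c / d * sum g (set xs) \<le> 1 * sum g (set xs)"
    using assms g0 by (intro mult_right_mono) auto
  then show ?thesis using True assms(5) by (intro exI[of _ "length xs"]) auto
next
  case False
  have g0: "sum g (set xs) \<ge> 0" using assms(4) by (intro sum_nonneg) auto
  define m where "m = (LEAST m. \<not> sum w (set (take m xs)) \<le> c)"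
  have ex: "\<not> sum w (set (take (length xs) xs)) \<le> c" using False by simp
  have m: "\<not> sum w (set (take m xs)) \<le> c" unfolding m_def using ex by (rule LeastI)
  have "m \<le> length xs" unfolding m_def using ex by (rule Least_le)
  have "m \<noteq> 0" using m assms(7) by (intro notI) simp
  then obtain k where k: "m = Suc k" by (cases m) auto
  have kc: "sum w (set (take k xs)) \<le> c" using not_less_Least[of k "\<lambda>m. \<not> sum w (set (take m xs)) \<le> c"] k
    unfolding m_def by simp
  have kl: "k < length xs" using \<open>m \<le> length xs\<close> k by simp
  have W: "sum w (set xs) > 0" using False assms(7) by simp
  have "c / d * sum g (set xs) \<le> c / sum w (set xs) * sum g (set xs)"
    using W g0 assms by (intro mult_right_mono divide_left_mono) auto
  also have "\<dots> \<le> sum w (set (take m xs)) / sum w (set xs) * sum g (set xs)"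
    using m W g0 by (intro mult_right_mono divide_right_mono) auto
  also have "\<dots> \<le> sum g (set (take m xs))"
    using density_prefix[OF assms(1-3), of m] W by (simp add: field_simps)
  also have "set (take m xs) = insert (xs ! k) (set (take k xs))"
    using kl k by (simp add: take_Suc_conv_app_nth)
  also have "sum g \<dots> \<le> M + sum g (set (take k xs))"
    using assms(4)[of "xs ! k"] kl by (simp add: sum.insert_if assms(4,5))
  finally show ?thesis using kc by (intro exI[of _ k]) auto
qed

section \<open>Prefixes of orderings built by appending\<close>

lemma prefix_within_superset:
  assumes "distinct (zs @ ys)" "\<And>x. x \<in> set (zs @ ys) \<Longrightarrow> w x > (0::real)" "sum w (set zs) \<le> c"
  shows "set zs \<subseteq> prefix_within w (zs @ ys) c"
proof -
  define A where "A = {k. k \<le> length (zs @ ys) \<and> (\<Sum>i<k. w ((zs @ ys) ! i)) \<le> c}"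
  have "(\<Sum>i<length zs. w ((zs @ ys) ! i)) = sum_list (map w zs)"
    unfolding sum_list_sum_nth by (simp add: atLeast0LessThan nth_append)
  also have "\<dots> = sum w (set zs)" using assms(1) by (simp add: sum_list_distinct_conv_sum_set)
  finally have "length zs \<in> A" using assms(3) by (simp add: A_def)
  moreover have "finite A" by (rule finite_subset[of _ "{..length (zs @ ys)}"]) (auto simp: A_def)
  ultimately have "length zs \<le> Max A" by (rule Max_ge[rotated])
  then have "set (take (length zs) (zs @ ys)) \<subseteq> set (take (Max A) (zs @ ys))"
    by (rule set_take_subset_set_take)
  then show ?thesis by (simp add: prefix_within_def A_def)
qed

lemma foldl_append_new_prefix: "\<exists>zs. foldl append_new xs yss = xs @ zs"
proof (induction yss arbitrary: xs)
  case (Cons ys yss)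
  show ?case using Cons[of "append_new xs ys"] by (auto simp: append_new_def)
qed simp

lemma set_append_new [simp]: "set (append_new xs ys) = set xs \<union> set ys"
  by (auto simp: append_new_def)

lemma set_foldl_append_new: "set (foldl append_new xs yss) = set xs \<union> (\<Union>ys\<in>set yss. set ys)"
  by (induction yss arbitrary: xs) auto

lemma distinct_foldl_append_new:
  assumes "distinct xs" "\<And>ys. ys \<in> set yss \<Longrightarrow> distinct ys"
  shows "distinct (foldl append_new xs yss)"
  using assms
proof (induction yss arbitrary: xs)
  case (Cons ys yss)
  then have "distinct (append_new xs ys)" by (auto simp: append_new_def)
  then show ?case using Cons by simp
qed simp

text \<open>Cutting a phase list short still yields an initial part of the ordering, so a phase that
  the capacity interrupts can be analysed.\<close>

lemma append_new_take_prefix: "\<exists>zs. append_new xs ys = append_new xs (take k ys) @ zs"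
proof -
  have "append_new xs ys = append_new xs (take k ys @ drop k ys)" by simp
  then show ?thesis unfolding append_new_def by (metis append.assoc filter_append)
qed

section \<open>The constants\<close>

lemma scale_lambda_bounds: "3.29235 \<le> scale_lambda" "scale_lambda \<le> 3.29245"
  using scale_lambda_approx unfolding abs_le_iff by auto

lemma scale_delta_mult: "scale_delta * (scale_lambda\<^sup>2 + 1) = scale_lambda ^ 3"
proof -
  have "scale_lambda\<^sup>2 + 1 > 0" by (simp add: add_nonneg_pos)
  then show ?thesis by (simp add: scale_delta_def)
qed

lemma scale_delta_bounds: "3.01 \<le> scale_delta" "scale_delta \<le> 3.02"
proof -
  let ?l = scale_lambda
  have l2: "3.29235\<^sup>2 \<le> ?l\<^sup>2" "?l\<^sup>2 \<le> 3.29245\<^sup>2"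
    using scale_lambda_bounds by (intro power_mono; simp)+
  have "3.29235 * ?l\<^sup>2 \<le> ?l * ?l\<^sup>2" "?l * ?l\<^sup>2 \<le> 3.29245 * ?l\<^sup>2"
    using scale_lambda_bounds by (intro mult_right_mono; simp)+
  then have "3.01 * (?l\<^sup>2 + 1) \<le> ?l ^ 3" "?l ^ 3 \<le> 3.02 * (?l\<^sup>2 + 1)"
    using l2 by (simp_all add: power3_eq_cube power2_eq_square)
  moreover have "?l\<^sup>2 + 1 > 0" by (simp add: add_nonneg_pos)
  ultimately show "3.01 \<le> scale_delta" "scale_delta \<le> 3.02"
    unfolding scale_delta_def by (simp_all add: pos_le_divide_eq pos_divide_le_eq)
qed

text \<open>By \<open>opt_growth\<close>, enlarging a budget by the factor \<delta> multiplies the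
  optimum by at most the left-hand side, provided that \<open>M\<close> is at most the fraction
  \<open>1 / \<lambda>\<^sup>2\<close> of the old optimum.\<close>

lemma scale_delta_lambda: "scale_delta * (1 + 1 / scale_lambda\<^sup>2) = scale_lambda"
proof -
  have "scale_lambda > 0" using scale_lambda_bounds by simp
  then have "scale_delta * (1 + 1 / scale_lambda\<^sup>2) = scale_delta * (scale_lambda\<^sup>2 + 1) / scale_lambda\<^sup>2"
    by (simp add: field_simps)
  also have "\<dots> = scale_lambda"
    unfolding scale_delta_mult using \<open>scale_lambda > 0\<close> by (simp add: power3_eq_cube power2_eq_square)
  finally show ?thesis .
qed

text \<open>The defining polynomial in the shape needed when phase 3 is interrupted. Relative to
  \<open>C 2\<close>, the optimum cannot have grown by \<rho> before capacity
  \<open>\<lambda>\<^sup>2 / (\<lambda> + 1)\<close>; phases 2 and 1 use up at most \<open>1\<close>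
  and \<open>1 / \<delta>\<close>; phase 3 has budget at most \<delta>; and
  \<open>1 / \<lambda>\<^sup>2\<close> accounts for the additive loss \<open>M\<close>.\<close>

lemma scale_lambda_equation:
  "(scale_lambda\<^sup>2 / (scale_lambda + 1) - 1 - 1 / scale_delta) / scale_delta - 1 / scale_lambda\<^sup>2
     = 1 / scale_lambda"
proof -
  define l where "l = scale_lambda"
  have l: "l > 0" using scale_lambda_bounds by (simp add: l_def)
  have d: "1 / scale_delta = (l\<^sup>2 + 1) / l ^ 3" by (simp add: scale_delta_def l_def)
  have "l^7 - 2 * l^6 - 3 * l^5 - 3 * l^4 - 3 * l^3 - 2 * l^2 - l - 1 = 0"
    using scale_lambda_root by (simp add: scale_poly_def l_def)
  \<comment> \<open>Moving everything to one side and expanding gives exactly the polynomial. The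
    factors come from clearing the denominators \<open>l + 1\<close> and
    \<open>l ^ 3\<close>.\<close>
  then have "(l^5 - l^4 - 2 * l^3 - l\<^sup>2 - l - 1) * (l\<^sup>2 + 1) = l^4 * (l + 1) * (l + 1)"
    by algebra
  moreover have "(l\<^sup>2 / (l + 1) - 1 - (l\<^sup>2 + 1) / l ^ 3) * ((l + 1) * l ^ 3) =
      l^5 - l^4 - 2 * l^3 - l\<^sup>2 - l - 1"
  proof -
    have "l\<^sup>2 / (l + 1) * ((l + 1) * l ^ 3) = l\<^sup>2 * l ^ 3" "(l\<^sup>2 + 1) / l ^ 3 * ((l + 1) * l ^ 3) = (l\<^sup>2 + 1) * (l + 1)"
      using l by simp_all
    then show ?thesis by algebra
  qed
  ultimately have "(l\<^sup>2 / (l + 1) - 1 - (l\<^sup>2 + 1) / l ^ 3) * (l\<^sup>2 + 1) * ((l + 1) * l^3) =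
      l^4 * (l + 1) * (l + 1)" by (simp add: mult_ac)
  then have "((l\<^sup>2 / (l + 1) - 1 - (l\<^sup>2 + 1) / l ^ 3) * (l\<^sup>2 + 1)) * ((l + 1) * l^3) =
      (l * (l + 1)) * ((l + 1) * l^3)" by algebra
  then have *: "(l\<^sup>2 / (l + 1) - 1 - (l\<^sup>2 + 1) / l ^ 3) * (l\<^sup>2 + 1) = l * (l + 1)"
    using l by simp
  have "(l\<^sup>2 / (l + 1) - 1 - 1 / scale_delta) / scale_delta =
      (l\<^sup>2 / (l + 1) - 1 - 1 / scale_delta) * (1 / scale_delta)" by simp
  also have "\<dots> = (l\<^sup>2 / (l + 1) - 1 - (l\<^sup>2 + 1) / l ^ 3) * (l\<^sup>2 + 1) / l ^ 3"
    unfolding d by simp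
  also have "\<dots> = 1 / l + 1 / l\<^sup>2"
    unfolding * using l by (simp add: field_simps power2_eq_square power3_eq_cube)
  finally show ?thesis by (simp add: l_def)
qed

lemma scale_rho_ge:
  assumes "M \<ge> 1"
  shows "scale_lambda \<le> scale_rho M" "2 * M \<le> scale_rho M"
    "scale_lambda\<^sup>2 * M \<le> (scale_rho M)\<^sup>2"
proof -
  have l: "scale_lambda > 0" using scale_lambda_bounds by simp
  have "scale_lambda * 1 \<le> scale_lambda * sqrt M"
    using assms l by (intro mult_left_mono) auto
  then show "scale_lambda \<le> scale_rho M" by (simp add: scale_rho_def)
  show "2 * M \<le> scale_rho M" by (simp add: scale_rho_def)
  have "(scale_lambda * sqrt M)\<^sup>2 \<le> (scale_rho M)\<^sup>2"
    using assms l by (intro power_mono) (auto simp: scale_rho_def)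
  then show "scale_lambda\<^sup>2 * M \<le> (scale_rho M)\<^sup>2" using assms by (simp add: power_mult_distrib)
qed

section \<open>Knapsack optima\<close>

locale knapsack_instance =
  fixes E :: "'a set" and w :: "'a \<Rightarrow> real" and f :: "'a set \<Rightarrow> real" and M :: real
    and S :: "real \<Rightarrow> 'a set" and \<gamma> :: "'a set \<Rightarrow> 'a \<Rightarrow> real"
  assumes finite_E: "finite E"
    and w_pos: "\<And>e. e \<in> E \<Longrightarrow> w e > 0"
    and M_ge_1: "M \<ge> 1"
    and f_nonneg: "\<And>A. A \<subseteq> E \<Longrightarrow> f A \<ge> 0"
    and monotone: "monotone_obj E f"
    and bounded: "bounded_obj M E f"
    and subadditive: "fractionally_subadditive E f"
    and optimal: "\<And>C. C > 0 \<Longrightarrow> optimal_set E w f C (S C)"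
    and lp_optimal: "\<And>X. X \<subseteq> E \<Longrightarrow> lp_optimal E f X (\<gamma> X)"
begin

abbreviation "opt \<equiv> opt_value E w f"
abbreviation "\<Lambda> \<equiv> scale_lambda"
abbreviation "\<delta> \<equiv> scale_delta"
abbreviation "\<rho> \<equiv> scale_rho M"

lemma rho_ge: "\<Lambda> \<le> \<rho>" "2 * M \<le> \<rho>" "\<Lambda>\<^sup>2 * M \<le> \<rho>\<^sup>2" "3 \<le> \<rho>"
  using scale_rho_ge[OF M_ge_1] scale_lambda_bounds by auto

lemma finite_sub: "X \<subseteq> E \<Longrightarrow> finite X"
  using finite_E by (rule rev_finite_subset)

lemma f_mono: "B \<subseteq> A \<Longrightarrow> A \<subseteq> E \<Longrightarrow> f B \<le> f A"
  using monotone by (auto simp: monotone_obj_def)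

lemma f_single: "e \<in> E \<Longrightarrow> 1 \<le> f {e}" "e \<in> E \<Longrightarrow> f {e} \<le> M"
  using bounded by (auto simp: bounded_obj_def)

lemma f_empty: "f {} = 0"
  using f_nonneg[of "{}"] fractionally_subadditive_empty[OF subadditive] by simp

lemma gamma_sum: "X \<subseteq> E \<Longrightarrow> sum (\<gamma> X) X = f X"
  using lp_optimal_sum[OF finite_E f_nonneg subadditive] lp_optimal by blast

lemma gamma_le: "X \<subseteq> E \<Longrightarrow> Y \<subseteq> E \<Longrightarrow> sum (\<gamma> X) Y \<le> f Y"
  using lp_optimal[of X] by (auto simp: lp_optimal_def lp_feasible_def)

lemma gamma_nonneg: "X \<subseteq> E \<Longrightarrow> e \<in> E \<Longrightarrow> 0 \<le> \<gamma> X e"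
  using lp_optimal[of X] by (auto simp: lp_optimal_def lp_feasible_def)

lemma gamma_le_single: "X \<subseteq> E \<Longrightarrow> e \<in> E \<Longrightarrow> \<gamma> X e \<le> f {e}"
  using gamma_le[of X "{e}"] by simp

lemma gamma_le_M: "X \<subseteq> E \<Longrightarrow> e \<in> E \<Longrightarrow> \<gamma> X e \<le> M"
  by (rule order_trans[OF gamma_le_single f_single(2)])

text \<open>The LP solution for \<open>insert e A\<close> is additive and tight on that set;
  feasibility bounds its parts on \<open>{e}\<close> and on \<open>A\<close> separately.\<close>

lemma f_insert_le:
  assumes "A \<subseteq> E" "e \<in> E"
  shows "f (insert e A) \<le> f {e} + f A"
proof -
  let ?g = "\<gamma> (insert e A)"
  have X: "insert e A \<subseteq> E" using assms by simp
  have "sum ?g (insert e A) \<le> ?g e + sum ?g A"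
    using finite_sub[OF assms(1)] gamma_nonneg[OF X assms(2)] by (simp add: sum.insert_if)
  then show ?thesis
    using gamma_sum[OF X] gamma_le_single[OF X assms(2)] gamma_le[OF X assms(1)] by simp
qed

lemma f_le_card:
  assumes "X \<subseteq> E" "\<And>x. x \<in> X \<Longrightarrow> f {x} \<le> K"
  shows "f X \<le> real (card X) * K"
proof -
  have "sum (\<gamma> X) X \<le> real (card X) * K"
    using assms gamma_le_single[OF assms(1)] by (intro sum_bounded_above) (meson order_trans subsetD)
  then show ?thesis using gamma_sum[OF assms(1)] by simp
qed

text \<open>Some element has at most the average share of the LP solution, and feasibility bounds
  what the others hold by the value of the remaining set.\<close>

lemma f_remove_one:
  assumes "X \<subseteq> E" "X \<noteq> {}"
  shows "\<exists>x\<in>X. f X \<le> f (X - {x}) + f X / card X"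
proof -
  have fin: "finite X" using finite_sub assms(1) .
  have "\<exists>x\<in>X. \<gamma> X x \<le> f X / card X"
  proof (rule ccontr)
    assume "\<not> ?thesis"
    then have "(\<Sum>x\<in>X. f X / card X) < sum (\<gamma> X) X"
      using fin assms(2) by (intro sum_strict_mono) auto
    then show False using gamma_sum[OF assms(1)] fin assms(2) by simp
  qed
  then obtain x where x: "x \<in> X" "\<gamma> X x \<le> f X / card X" by blast
  have "f X = \<gamma> X x + sum (\<gamma> X) (X - {x})"
    using gamma_sum[OF assms(1)] sum.remove[OF fin x(1), of "\<gamma> X"] by simp
  moreover have "sum (\<gamma> X) (X - {x}) \<le> f (X - {x})"
    using assms(1) by (intro gamma_le) auto
  ultimately have "f X \<le> f (X - {x}) + f X / card X" using x(2) by linarith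
  then show ?thesis using x(1) by blast
qed

lemma weight_nonneg: "X \<subseteq> E \<Longrightarrow> 0 \<le> sum w X"
  using w_pos by (intro sum_nonneg) (auto intro: less_imp_le)

lemma weight_mono: "Y \<subseteq> X \<Longrightarrow> X \<subseteq> E \<Longrightarrow> sum w Y \<le> sum w X"
  using w_pos finite_sub by (intro sum_mono2) (auto intro: less_imp_le)

lemma weight_Un_le:
  assumes "A \<subseteq> E" "B \<subseteq> E"
  shows "sum w (A \<union> B) \<le> sum w A + sum w B"
  using sum.union_inter[of A B w] weight_nonneg[of "A \<inter> B"] assms finite_sub by force

lemma card_weight: "X \<subseteq> E \<Longrightarrow> real (card X) * Min (w ` E) \<le> sum w X"
  using finite_E by (intro sum_bounded_below) auto

lemma opt_ge: "X \<subseteq> E \<Longrightarrow> sum w X \<le> c \<Longrightarrow> f X \<le> opt c"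
  using opt_value_ge_iff[OF finite_E, of c "f X" w f] weight_nonneg[of X] by fastforce

lemma S_facts: "c > 0 \<Longrightarrow> S c \<subseteq> E" "c > 0 \<Longrightarrow> sum w (S c) \<le> c" "c > 0 \<Longrightarrow> f (S c) = opt c"
  using optimal by (auto simp: optimal_set_def)

lemma opt_mono: "0 < c \<Longrightarrow> c \<le> d \<Longrightarrow> opt c \<le> opt d"
  using S_facts[of c] opt_ge[of "S c" d] by simp

text \<open>On subsets of \<open>E\<close> the LP solution is an additive lower bound for
  \<open>f\<close> that is tight on \<open>X\<close>, so the estimate of
  \<open>greedy_prefix\<close> carries over to \<open>f\<close>.\<close>

lemma phase_prefix:
  assumes "X \<subseteq> E" "sum w X \<le> d" "phase_list w f X (\<gamma> X) i xs" "i \<ge> 3"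
    and "0 \<le> c" "c \<le> d" "0 < d"
  shows "\<exists>k. sum w (set (take k xs)) \<le> c \<and> c / d * f X - M \<le> f (set (take k xs))"
proof -
  have xs: "distinct xs" "set xs = X"
    and dens: "\<And>j. Suc j < length xs \<Longrightarrow> \<gamma> X (xs ! j) / w (xs ! j) \<ge> \<gamma> X (xs ! Suc j) / w (xs ! Suc j)"
    using assms(3,4) by (auto simp: phase_list_def is_ordering_def)
  have "\<exists>k. sum w (set (take k xs)) \<le> c \<and>
      c / d * sum (\<gamma> X) (set xs) - M \<le> sum (\<gamma> X) (set (take k xs))"
  proof (rule greedy_prefix[OF xs(1) _ dens])
    fix x assume "x \<in> set xs"
    then have "x \<in> E" using xs assms(1) by auto
    then show "w x > 0" "0 \<le> \<gamma> X x \<and> \<gamma> X x \<le> M"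
      using w_pos gamma_nonneg gamma_le_M assms(1) by auto
  qed (use assms xs M_ge_1 in auto)
  then obtain k where k: "sum w (set (take k xs)) \<le> c"
    "c / d * sum (\<gamma> X) (set xs) - M \<le> sum (\<gamma> X) (set (take k xs))" by blast
  have "set (take k xs) \<subseteq> E" using set_take_subset[of k xs] xs assms(1) by auto
  then show ?thesis using k gamma_sum[OF assms(1)] gamma_le[OF assms(1)] xs(2) by (metis order_trans)
qed

text \<open>A density-ordered optimal set for \<open>d\<close>, cut at capacity \<open>c\<close>,
  competes for the optimum at \<open>c\<close>.\<close>

lemma opt_growth:
  assumes "0 < c" "c \<le> d"
  shows "opt d \<le> d / c * (opt c + M)"
proof -
  have d: "d > 0" using assms by simp
  note X = S_facts[OF d]
  \<comment> \<open>The index 3 only selects the density rule; no particular run is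
    involved.\<close>
  have "\<exists>xs. phase_list w f (S d) (\<gamma> (S d)) 3 xs"
    using finite_sub[OF X(1)] by (intro phase_list_exists) auto
  then obtain xs where xs: "phase_list w f (S d) (\<gamma> (S d)) 3 xs" by blast
  from phase_prefix[OF X(1,2) xs, of c] assms d X(3)
  obtain k where k: "sum w (set (take k xs)) \<le> c" "c / d * opt d - M \<le> f (set (take k xs))"
    by auto
  have "set (take k xs) \<subseteq> E"
    using set_take_subset[of k xs] xs X(1) by (auto simp: phase_list_def is_ordering_def)
  then have "c / d * opt d \<le> opt c + M" using k opt_ge[of "set (take k xs)" c] by simp
  then show ?thesis using assms d by (simp add: field_simps)
qed

text \<open>On the reals \<open>LEAST\<close> is a lower bound only if the minimum is attained. It
  is, because only finitely many candidates matter: \<open>\<delta> * c\<close> and the weights of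
  subsets of \<open>E\<close>.\<close>

lemma next_budgets_Least_le:
  assumes "c > 0" "C \<in> next_budgets E w f M c"
  shows "(LEAST C. C \<in> next_budgets E w f M c) \<le> C"
proof -
  define T where "T = insert (\<delta> * c) (sum w ` Pow E) \<inter> next_budgets E w f M c"
  have dc: "\<delta> * c > 0" using assms(1) scale_delta_gt_1 by simp
  have T: "\<exists>t\<in>T. t \<le> D" if D: "D \<in> next_budgets E w f M c" for D
  proof -
    have D': "\<delta> * c \<le> D" "D < sum w E" "\<rho> * opt c \<le> opt D"
      using D by (auto simp: next_budgets_def)
    then have "D > 0" using dc by simp
    note X = S_facts[OF this]
    \<comment> \<open>Lowering \<open>D\<close> to \<open>t\<close> keeps \<open>S D\<close>
      affordable and hence preserves the optimum.\<close>
    define t where "t = max (\<delta> * c) (sum w (S D))"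
    have "opt D \<le> opt t" unfolding X(3)[symmetric] by (rule opt_ge) (auto simp: X t_def)
    moreover have "t \<le> D" using D' X by (simp add: t_def)
    ultimately have "t \<in> T" using X D' by (auto simp: T_def next_budgets_def t_def max_def)
    then show ?thesis using \<open>t \<le> D\<close> by blast
  qed
  have fin: "finite T" using finite_E by (simp add: T_def)
  have "T \<noteq> {}" using T assms(2) by blast
  have le: "Min T \<le> D" if "D \<in> next_budgets E w f M c" for D
    using T[OF that] Min_le[OF fin] by (meson order_trans)
  have "Min T \<in> next_budgets E w f M c"
    using Min_in[OF fin \<open>T \<noteq> {}\<close>] by (simp add: T_def)
  then have "(LEAST C. C \<in> next_budgets E w f M c) = Min T" using le by (rule Least_equality)
  then show ?thesis using le[OF assms(2)] by simp
qed

end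

section \<open>Runs of the algorithm\<close>

lemma phase_list_ordering: "phase_list w f X g i ys \<Longrightarrow> distinct ys \<and> set ys = X"
  by (auto simp: phase_list_def is_ordering_def split: if_splits)

locale scale_run = knapsack_instance +
  fixes N :: nat and C :: "nat \<Rightarrow> real" and xs :: "nat \<Rightarrow> 'a list" and rest :: "'a list"
  assumes E_nonempty: "E \<noteq> {}"
    and budgets: "scale_budgets E w f M N C"
    and phases: "\<And>i. 1 \<le> i \<Longrightarrow> i \<le> N \<Longrightarrow> phase_list w f (S (C i)) (\<gamma> (S (C i))) i (xs i)"
    and rest: "is_ordering (E - set (foldl append_new [] (map xs [1..<Suc N]))) rest"
begin

definition order :: "'a list" where
  "order = foldl append_new [] (map xs [1..<Suc N]) @ rest"

section \<open>Growth of budgets and optima along a run\<close>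

lemma C_1: "C 1 = Min (w ` E)" and C_N: "C N = sum w E" and N_ge_2: "N \<ge> 2"
  using budgets unfolding scale_budgets_def by blast+

lemma C_1_pos: "C 1 > 0"
  unfolding C_1 using finite_E E_nonempty w_pos by simp

lemma C_1_le: "e \<in> E \<Longrightarrow> C 1 \<le> w e"
  unfolding C_1 using finite_E by simp

lemma total_pos: "sum w E > 0"
  using finite_E E_nonempty w_pos by (intro sum_pos) auto

lemma C_Suc:
  assumes "1 \<le> i" "Suc i < N"
  shows "next_budgets E w f M (C i) \<noteq> {}" "C (Suc i) = (LEAST c. c \<in> next_budgets E w f M (C i))"
proof -
  have "Suc i \<in> {2..<N}" using assms by simp
  then have "next_budgets E w f M (C (Suc i - 1)) \<noteq> {} \<and>
      C (Suc i) = (LEAST c. c \<in> next_budgets E w f M (C (Suc i - 1)))"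
    using budgets unfolding scale_budgets_def by blast
  then show "next_budgets E w f M (C i) \<noteq> {}" "C (Suc i) = (LEAST c. c \<in> next_budgets E w f M (C i))"
    by simp_all
qed

lemma C_pos: "1 \<le> i \<Longrightarrow> i < N \<Longrightarrow> C i > 0"
proof (induction i rule: dec_induct)
  case base
  then show ?case using C_1_pos by simp
next
  case (step i)
  then have pos: "C i > 0" by simp
  have "C (Suc i) \<in> next_budgets E w f M (C i)"
    using C_Suc[of i] step next_budgets_Least[OF finite_E pos] by simp
  then have "\<delta> * C i \<le> C (Suc i)" by (simp add: next_budgets_def)
  moreover have "\<delta> * C i > 0" using pos scale_delta_gt_1 by simp
  ultimately show ?case by simp
qed

lemma C_pos': "1 \<le> i \<Longrightarrow> i \<le> N \<Longrightarrow> C i > 0"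
  using C_pos[of i] C_N total_pos by (cases "i = N") auto

lemma C_Suc_mem:
  assumes "1 \<le> i" "Suc i < N"
  shows "C (Suc i) \<in> next_budgets E w f M (C i)"
proof -
  have "C i > 0" using C_pos[of i] assms by simp
  then show ?thesis using C_Suc[OF assms] next_budgets_Least[OF finite_E] by simp
qed

lemma C_step:
  assumes "1 \<le> i" "Suc i < N"
  shows "\<delta> * C i \<le> C (Suc i)" "C (Suc i) < sum w E" "\<rho> * opt (C i) \<le> opt (C (Suc i))"
  using C_Suc_mem[OF assms] by (auto simp: next_budgets_def)

lemma C_minimal:
  assumes "1 \<le> i" "i < N" "\<delta> * C i \<le> c" "c < sum w E" "\<rho> * opt (C i) \<le> opt c"
  shows "Suc i < N \<and> C (Suc i) \<le> c"
proof -
  have mem: "c \<in> next_budgets E w f M (C i)" using assms by (simp add: next_budgets_def)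
  have "Suc i \<noteq> N"
  proof
    assume "Suc i = N"
    moreover have "next_budgets E w f M (C (N - 1)) = {}" using budgets unfolding scale_budgets_def by blast
    ultimately have "next_budgets E w f M (C i) = {}" by auto
    then show False using mem by simp
  qed
  then show ?thesis
    using C_Suc[of i] next_budgets_Least_le[OF C_pos mem] assms by auto
qed

text \<open>By monotonicity of the optimum, \<open>\<delta> * C i\<close> itself qualifies as the
  next budget, unless it is at least the total weight, which no budget exceeds.\<close>

lemma C_Suc_le:
  assumes "1 \<le> i" "i < N" "0 < c" "c \<le> \<delta> * C i" "\<rho> * opt (C i) \<le> opt c"
  shows "C (Suc i) \<le> \<delta> * C i"
proof (cases "\<delta> * C i < sum w E")
  case True
  then show ?thesis using C_minimal[of i "\<delta> * C i"] assms opt_mono[of c "\<delta> * C i"] by simp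
next
  case False
  have "C (Suc i) \<le> sum w E" using C_step(2)[of i] C_N assms by (cases "Suc i = N") auto
  then show ?thesis using False by simp
qed

lemma opt_lt:
  assumes "1 \<le> i" "i < N" "c < C (Suc i)" "\<delta> * C i \<le> c"
  shows "opt c < \<rho> * opt (C i)"
proof (rule ccontr)
  assume "\<not> ?thesis"
  moreover have "C (Suc i) \<le> sum w E" using C_step(2)[of i] C_N assms by (cases "Suc i = N") auto
  ultimately show False using C_minimal[of i c] assms by auto
qed

text \<open>Budgets grow at least geometrically with ratio \<delta>. Since \<delta> exceeds 3, all
  phases before \<open>i\<close> together cost at most half of \<open>C i\<close>.\<close>

lemma sum_C: "1 \<le> i \<Longrightarrow> i < N \<Longrightarrow> (\<delta> - 1) * (\<Sum>j\<in>{1..<i}. C j) \<le> C i"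
proof (induction i rule: dec_induct)
  case base
  then show ?case using C_1_pos by simp
next
  case (step i)
  then have "(\<delta> - 1) * (\<Sum>j\<in>{1..<Suc i}. C j) \<le> C i + (\<delta> - 1) * C i"
    by (simp add: distrib_left)
  also have "\<dots> = \<delta> * C i" by (simp add: algebra_simps)
  also have "\<dots> \<le> C (Suc i)" using C_step(1)[of i] step by simp
  finally show ?case .
qed

lemma opt_C_1: "1 \<le> opt (C 1)"
proof -
  have "Min (w ` E) \<in> w ` E" using finite_E E_nonempty by simp
  then obtain e where "e \<in> E" "w e = C 1" unfolding C_1 by force
  then show ?thesis using f_single(1)[of e] opt_ge[of "{e}" "C 1"] by simp
qed

lemma opt_C_2: "2 < N \<Longrightarrow> \<rho> \<le> opt (C 2)"
proof -
  assume "2 < N"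
  then have "\<rho> * opt (C 1) \<le> opt (C 2)" using C_step(3)[of 1] by (simp add: numeral_2_eq_2)
  moreover have "\<rho> * 1 \<le> \<rho> * opt (C 1)" using opt_C_1 rho_ge by (intro mult_left_mono) auto
  ultimately show ?thesis by simp
qed

lemma opt_C_ge_3: "3 \<le> i \<Longrightarrow> i < N \<Longrightarrow> \<rho>\<^sup>2 \<le> opt (C i)"
proof (induction i rule: dec_induct)
  case base
  then have "\<rho> * opt (C 2) \<le> opt (C 3)" using C_step(3)[of 2] by (simp add: numeral_3_eq_3)
  moreover have "\<rho> * \<rho> \<le> \<rho> * opt (C 2)" using opt_C_2 base rho_ge by (intro mult_left_mono) auto
  ultimately show ?case by (simp add: power2_eq_square)
next
  case (step i)
  then have IH: "\<rho>\<^sup>2 \<le> opt (C i)" by simp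
  have "1 * \<rho>\<^sup>2 \<le> \<rho> * opt (C i)" using IH rho_ge by (intro mult_mono) auto
  then show ?case using C_step(3)[of i] step by simp
qed

section \<open>What a given capacity contains\<close>

lemma S_C:
  assumes "1 \<le> i" "i \<le> N"
  shows "S (C i) \<subseteq> E" "sum w (S (C i)) \<le> C i" "f (S (C i)) = opt (C i)"
  using S_facts C_pos'[OF assms] by blast+

lemma xs_ordering: "1 \<le> i \<Longrightarrow> i \<le> N \<Longrightarrow> distinct (xs i) \<and> set (xs i) = S (C i)"
  by (rule phase_list_ordering[OF phases])

lemma set_done: "i \<le> N \<Longrightarrow> set (foldl append_new [] (map xs [1..<Suc i])) = (\<Union>j\<in>{1..<Suc i}. S (C j))"
  unfolding set_foldl_append_new using xs_ordering by (simp add: SUP_image del: upt_Suc)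

lemma order_ordering: "is_ordering E order"
proof -
  let ?\<sigma> = "foldl append_new [] (map xs [1..<Suc N])"
  have "distinct ?\<sigma>"
    using xs_ordering by (intro distinct_foldl_append_new) (auto simp del: upt_Suc)
  moreover have "set ?\<sigma> \<subseteq> E" unfolding set_done[OF order_refl] by (intro UN_least S_C(1)) auto
  ultimately show ?thesis using rest by (auto simp: order_def is_ordering_def)
qed

lemma sum_weight_S_le: "i \<le> Suc N \<Longrightarrow> sum w (\<Union>j\<in>{1..<i}. S (C j)) \<le> (\<Sum>j\<in>{1..<i}. C j)"
proof (induction i)
  case (Suc i)
  show ?case
  proof (cases "i = 0")
    case False
    then have i: "1 \<le> i" "i \<le> N" using Suc by auto
    have U: "(\<Union>j\<in>{1..<i}. S (C j)) \<subseteq> E" using i by (intro UN_least S_C(1)) auto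
    have "(\<Union>j\<in>{1..<Suc i}. S (C j)) = (\<Union>j\<in>{1..<i}. S (C j)) \<union> S (C i)"
      using i by (auto simp: atLeastLessThanSuc)
    then have "sum w (\<Union>j\<in>{1..<Suc i}. S (C j)) \<le> sum w (\<Union>j\<in>{1..<i}. S (C j)) + sum w (S (C i))"
      using weight_Un_le[OF U S_C(1)[OF i]] by simp
    then show ?thesis using Suc S_C(2)[OF i] i by simp
  qed simp
qed simp

text \<open>Each earlier phase is charged its full budget. Skipping elements appended before only
  lowers the true weight, so the listed elements fit.\<close>

lemma reach:
  assumes "1 \<le> i" "i \<le> N" "(\<Sum>j\<in>{1..<i}. C j) + sum w (set (take k (xs i))) \<le> c"
  shows "(\<Union>j\<in>{1..<i}. S (C j)) \<union> set (take k (xs i)) \<subseteq> prefix_within w order c"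
proof -
  define Q where "Q = foldl append_new [] (map xs [1..<i])"
  have "[1..<Suc N] = [1..<i] @ i # [Suc i..<Suc N]"
    using upt_add_eq_append[of 1 i "Suc N - i"] upt_conv_Cons[of i "Suc N"] assms(1,2)
    by (simp del: upt_Suc)
  then have "foldl append_new [] (map xs [1..<Suc N]) =
      foldl append_new (append_new Q (xs i)) (map xs [Suc i..<Suc N])"
    by (simp add: Q_def del: upt_Suc)
  then obtain zs where zs: "order = append_new Q (take k (xs i)) @ zs"
    using foldl_append_new_prefix[of "append_new Q (xs i)" "map xs [Suc i..<Suc N]"]
      append_new_take_prefix[of Q "xs i" k] unfolding order_def by auto
  have Q: "set Q = (\<Union>j\<in>{1..<i}. S (C j))"
    using set_done[of "i - 1"] assms(1,2) by (simp add: Q_def del: upt_Suc)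
  have U: "(\<Union>j\<in>{1..<i}. S (C j)) \<subseteq> E" using assms(2) by (intro UN_least S_C(1)) auto
  have T: "set (take k (xs i)) \<subseteq> E"
    using set_take_subset[of k "xs i"] xs_ordering[OF assms(1,2)] S_C(1)[OF assms(1,2)] by auto
  have "sum w (set (append_new Q (take k (xs i)))) \<le> c"
    using weight_Un_le[OF U T] sum_weight_S_le[of i] assms Q by simp
  then have "set (append_new Q (take k (xs i))) \<subseteq> prefix_within w order c"
    using order_ordering w_pos unfolding zs
    by (intro prefix_within_superset) (auto simp: is_ordering_def)
  then show ?thesis using Q by simp
qed

abbreviation "P c \<equiv> prefix_within w order c"

lemma prefix_subset: "P c \<subseteq> E"
  using order_ordering set_take_subset unfolding prefix_within_def is_ordering_def by metis

lemma f_reach_phase: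
  assumes "1 \<le> i" "i \<le> N" "(\<Sum>j\<in>{1..<i}. C j) + sum w (set (take k (xs i))) \<le> c"
  shows "f (set (take k (xs i))) \<le> f (P c)"
  using reach[OF assms] by (intro f_mono prefix_subset) auto

lemma f_reach_done:
  assumes "1 \<le> i" "i \<le> N" "(\<Sum>j\<in>{1..<Suc i}. C j) \<le> c"
  shows "opt (C i) \<le> f (P c)"
proof -
  have "(\<Sum>j\<in>{1..<i}. C j) + sum w (set (take (length (xs i)) (xs i))) \<le> c"
    using assms S_C(2)[of i] xs_ordering[of i] by simp
  from f_reach_phase[OF assms(1,2) this] show ?thesis
    using xs_ordering[of i] S_C(3)[of i] assms by simp
qed

lemma f_reach_greedy:
  assumes "3 \<le> i" "i \<le> N" "(\<Sum>j\<in>{1..<i}. C j) \<le> c" "c - (\<Sum>j\<in>{1..<i}. C j) \<le> C i"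
  shows "(c - (\<Sum>j\<in>{1..<i}. C j)) / C i * opt (C i) - M \<le> f (P c)"
proof -
  have i: "1 \<le> i" using assms by simp
  obtain k where k: "sum w (set (take k (xs i))) \<le> c - (\<Sum>j\<in>{1..<i}. C j)"
    "(c - (\<Sum>j\<in>{1..<i}. C j)) / C i * f (S (C i)) - M \<le> f (set (take k (xs i)))"
    using phase_prefix[OF S_C(1,2)[OF i assms(2)] phases[OF i assms(2)] assms(1) _ assms(4)]
      assms(3) C_pos'[OF i assms(2)] by auto
  then show ?thesis using f_reach_phase[OF i assms(2), of k c] S_C(3)[OF i assms(2)] by simp
qed

section \<open>Competitiveness phase by phase\<close>

lemma f_prefix_nonneg: "0 \<le> f (P c)"
  using f_nonneg prefix_subset by blast

text \<open>Two elements are worth at most \<open>2 * M\<close>, which is at most \<rho>.\<close>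

lemma two_elements:
  assumes "c > 0" "card (S c) \<le> 2" "1 \<le> f (P c)"
  shows "opt c \<le> \<rho> * f (P c)"
proof -
  have X: "S c \<subseteq> E" using S_facts assms by blast
  then have "f (S c) \<le> real (card (S c)) * M" using f_single(2) by (intro f_le_card) auto
  also have "\<dots> \<le> 2 * M" using assms(2) M_ge_1 by (intro mult_right_mono) auto
  also have "\<dots> \<le> \<rho> * 1" using rho_ge by simp
  also have "\<dots> \<le> \<rho> * f (P c)" using assms(3) rho_ge by (intro mult_left_mono) auto
  finally show ?thesis using S_facts(3)[OF assms(1)] by simp
qed

text \<open>If the optimum has not grown by \<rho>, the first element suffices. Otherwise
  \<open>C 2\<close> is below \<open>4 * C 1\<close>, so \<open>S (C 2)\<close> has at most three
  elements. Unless one of \<open>S c\<close> and \<open>S (C 2)\<close> has at most two elements,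
  the most valuable element of \<open>S (C 2)\<close> is already in the prefix and carries at least
  a third of \<open>opt (C 2)\<close>.\<close>

lemma phase_1:
  assumes "C 1 \<le> c" "c < C 2"
  shows "opt c \<le> \<rho> * f (P c)"
proof (cases "\<delta> * C 1 \<le> c \<or> opt c < \<rho> * opt (C 1)")
  case True
  have "opt c < \<rho> * opt (C 1)"
    using True opt_lt[of 1 c] assms(2) N_ge_2 by (auto simp: numeral_2_eq_2)
  also have "\<dots> \<le> \<rho> * f (P c)"
    using f_reach_done[of 1 c] assms(1) N_ge_2 rho_ge by (intro mult_left_mono) auto
  finally show ?thesis by simp
next
  case False
  have c: "c > 0" using assms C_1_pos by simp
  have f1: "1 \<le> f (P c)" using f_reach_done[of 1 c] assms(1) N_ge_2 opt_C_1 by simp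
  have C2: "C 2 \<le> \<delta> * C 1" using C_Suc_le[of 1 c] c False N_ge_2 by (simp add: numeral_2_eq_2)
  have bd: "\<delta> * C 1 < 4 * C 1" using scale_delta_bounds C_1_pos by (intro mult_strict_right_mono) auto
  have C2_pos: "C 2 > 0" using assms c by simp
  note X = S_facts[OF c] and Y = S_facts[OF C2_pos]
  have cardw: "real (card Z) * C 1 \<le> sum w Z" if "Z \<subseteq> E" for Z
    using card_weight[OF that] unfolding C_1 .
  show ?thesis
  proof (cases "card (S c) \<le> 2 \<or> card (S (C 2)) \<le> 2")
    case True
    then show ?thesis
    proof
      assume "card (S c) \<le> 2"
      then show ?thesis using two_elements c f1 by simp
    next
      assume "card (S (C 2)) \<le> 2"
      have "opt c \<le> f (S (C 2))" using opt_mono[of c "C 2"] c assms Y by simp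
      also have "\<dots> \<le> real (card (S (C 2))) * M" using f_single(2) Y(1) by (intro f_le_card) auto
      also have "\<dots> \<le> 2 * M" using \<open>card (S (C 2)) \<le> 2\<close> M_ge_1 by (intro mult_right_mono) auto
      also have "\<dots> \<le> \<rho> * 1" using rho_ge by simp
      also have "\<dots> \<le> \<rho> * f (P c)" using f1 rho_ge by (intro mult_left_mono) auto
      finally show ?thesis .
    qed
  next
    case False
    have "3 * C 1 \<le> real (card (S c)) * C 1" using False C_1_pos by (intro mult_right_mono) auto
    then have c3: "3 * C 1 \<le> c" using cardw[OF X(1)] X(2) by simp
    have "real (card (S (C 2))) * C 1 < 4 * C 1" using cardw[OF Y(1)] Y(2) C2 bd by linarith
    then have "real (card (S (C 2))) < real 4" using C_1_pos by simp
    then have card3: "card (S (C 2)) \<le> 3" unfolding of_nat_less_iff by simp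
    obtain e ys where e: "xs 2 = e # ys" "\<forall>x\<in>S (C 2). f {x} \<le> f {e}"
      using phases[of 2] N_ge_2 by (auto simp: phase_list_def)
    have eS: "e \<in> S (C 2)" using xs_ordering[of 2] N_ge_2 e by auto
    have fin: "finite (S (C 2))" using finite_sub Y(1) .
    \<comment> \<open>The other elements of \<open>S (C 2)\<close> weigh at least
      \<open>2 * C 1\<close>, which leaves less than \<open>2 * C 1\<close> for \<open>e\<close>.
      Together with the first phase this stays below \<open>3 * C 1\<close>, hence below
      \<open>c\<close>.\<close>
    have "2 * C 1 \<le> real (card (S (C 2) - {e})) * C 1"
      using False eS fin C_1_pos by (intro mult_right_mono) auto
    also have "\<dots> \<le> sum w (S (C 2) - {e})" using Y(1) by (intro cardw) auto
    also have "\<dots> = sum w (S (C 2)) - w e" using fin eS by (simp add: sum_diff1)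
    finally have "C 1 + w e \<le> c" using Y(2) C2 bd c3 C_1_pos by linarith
    then have "f {e} \<le> f (P c)" using f_reach_phase[of 2 1 c] e N_ge_2 by (simp add: numeral_2_eq_2)
    have "opt c \<le> f (S (C 2))" using opt_mono[of c "C 2"] c assms Y by simp
    also have "\<dots> \<le> real (card (S (C 2))) * f {e}" using Y(1) e by (intro f_le_card) auto
    also have "\<dots> \<le> \<rho> * f {e}"
      using card3 rho_ge f_nonneg[of "{e}"] eS Y(1) by (intro mult_right_mono) auto
    also have "\<dots> \<le> \<rho> * f (P c)" using \<open>f {e} \<le> f (P c)\<close> rho_ge by (intro mult_left_mono) auto
    finally show ?thesis .
  qed
qed

text \<open>Let \<open>S c\<close> have at least three elements. Dropping a cheapest share loses at
  most a third and brings the weight below \<open>C 2\<close>, so \<open>opt c\<close> is at most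
  \<open>3 / 2 * opt (C 2)\<close>. At most the last element of phase 2 is missing from the prefix,
  and since the phase starts with its most valuable element, at least half of
  \<open>opt (C 2)\<close> is present. The resulting factor is 3.\<close>

lemma phase_2_incomplete:
  assumes "2 < N" "C 2 \<le> c" "c < C 1 + C 2"
  shows "opt c \<le> \<rho> * f (P c)"
proof -
  have c: "c > 0" using assms C_pos[of 2] by simp
  have C12: "\<delta> * C 1 \<le> C 2" using C_step(1)[of 1] assms by (simp add: numeral_2_eq_2)
  then have "1 * C 1 \<le> C 2" using scale_delta_gt_1 C_1_pos mult_right_mono[of 1 \<delta> "C 1"] by linarith
  then have f1: "1 \<le> f (P c)" using f_reach_done[of 1 c] assms opt_C_1 by simp
  show ?thesis
  proof (cases "card (S c) \<le> 2")
    case True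
    then show ?thesis using two_elements c f1 by simp
  next
    case False
    note X = S_facts[OF c]
    have "S c \<noteq> {}" using False by auto
    then obtain x where x: "x \<in> S c" "f (S c) \<le> f (S c - {x}) + f (S c) / card (S c)"
      using f_remove_one X(1) by blast
    have "f (S c) / card (S c) \<le> f (S c) / 3"
      using False f_nonneg X(1) by (intro divide_left_mono) auto
    moreover have "sum w (S c - {x}) \<le> C 2"
      using x(1) X finite_sub[OF X(1)] C_1_le[of x] assms by (auto simp: sum_diff1)
    then have "f (S c - {x}) \<le> opt (C 2)" using X(1) by (intro opt_ge) auto
    ultimately have 1: "opt c \<le> 3 / 2 * opt (C 2)" using x(2) unfolding X(3) by argo
    obtain e ys where e: "xs 2 = e # ys" "\<forall>x\<in>S (C 2). f {x} \<le> f {e}"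
      using phases[of 2] assms by (auto simp: phase_list_def)
    have set2: "set (e # ys) = S (C 2)" and dist: "distinct (e # ys)"
      using xs_ordering[of 2] assms e by auto
    have Y: "S (C 2) \<subseteq> E" "sum w (S (C 2)) \<le> C 2" "f (S (C 2)) = opt (C 2)"
      using S_C[of 2] assms by auto
    have eE: "e \<in> E" using Y set2 by auto
    \<comment> \<open>A single element is worth at most \<open>M\<close>, less than the lower bound
      \<rho> for \<open>opt (C 2)\<close>; so the first and last elements of the phase
      differ.\<close>
    have "ys \<noteq> []"
    proof
      assume "ys = []"
      then have "opt (C 2) \<le> M" using Y set2 f_single(2)[OF eE] by simp
      then show False using opt_C_2 assms rho_ge M_ge_1 by simp
    qed
    then obtain zs e' where ys: "ys = zs @ [e']" by (metis rev_exhaust)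
    have e': "e' \<in> S (C 2)" "e' \<in> E" using set2 Y ys by auto
    have zsE: "set (e # zs) \<subseteq> E" using set2 Y ys by auto
    have S2: "S (C 2) = insert e' (set (e # zs))" "e' \<notin> set (e # zs)" using set2 ys dist by auto
    have "sum w (set (e # zs)) + w e' \<le> C 2"
      using Y(2) S2(2) unfolding S2(1) by (simp del: set_simps add: add.commute)
    then have "C 1 + sum w (set (e # zs)) \<le> c" using C_1_le[OF e'(2)] assms by simp
    moreover have "take (Suc (length zs)) (xs 2) = e # zs" using e ys by simp
    ultimately have 2: "f (set (e # zs)) \<le> f (P c)"
      using f_reach_phase[of 2 "Suc (length zs)" c] assms by (simp add: numeral_2_eq_2)
    have "opt (C 2) \<le> f {e'} + f (set (e # zs))"
      using f_insert_le[OF zsE e'(2)] Y(3) S2(1) by simp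
    moreover have "f {e'} \<le> f {e}" using e e' by blast
    moreover have "f {e} \<le> f (set (e # zs))" using zsE by (intro f_mono) auto
    ultimately have "opt c \<le> 3 * f (P c)" using 1 2 by simp
    also have "\<dots> \<le> \<rho> * f (P c)" using rho_ge f1 by (intro mult_right_mono) auto
    finally show ?thesis .
  qed
qed

text \<open>If the optimum has already grown by the factor \<open>\<rho>\<close>, then phase 3 has budget at most \<open>\<delta> * C 2\<close>
  and \<open>c\<close> is so large that the part of \<open>S (C 3)\<close> inside the prefix suffices. At \<open>M = 1\<close> this
  estimate is an equality, by the choice of \<open>\<lambda>\<close>.\<close>

lemma phase_2_complete:
  assumes "2 < N" "C 1 + C 2 \<le> c" "c < C 3"
  shows "opt c \<le> \<rho> * f (P c)"
proof (cases "opt c < \<rho> * opt (C 2)")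
  case True
  also have "\<rho> * opt (C 2) \<le> \<rho> * f (P c)"
    using f_reach_done[of 2 c] assms rho_ge by (intro mult_left_mono) (auto simp: numeral_3_eq_3 numeral_2_eq_2)
  finally show ?thesis by simp
next
  case False
  have C2: "C 2 > 0" using C_pos assms by simp
  have c: "c > 0" using assms C2 C_1_pos by simp
  define G where "G = opt c"
  define F where "F = opt (C 2)"
  define x where "x = c / C 2"
  have cx: "c = x * C 2" using C2 by (simp add: x_def)
  have G: "\<rho> * F \<le> G" using False by (simp add: G_def F_def)
  have F: "\<rho> \<le> F" using opt_C_2 assms by (simp add: F_def)
  have l: "\<Lambda> > 3" using scale_lambda_bounds by simp
  have r: "\<rho> > 0" "F > 0" using rho_ge F by auto
  then have G0: "G > 0" using G mult_pos_pos[of \<rho> F] by linarith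
  have c_le: "c \<le> \<delta> * C 2"
    using opt_lt[of 2 c] False assms by (force simp: numeral_3_eq_3 numeral_2_eq_2)
  have C3: "C 3 \<le> \<delta> * C 2"
    using C_Suc_le[of 2 c] c c_le False assms by (simp add: numeral_3_eq_3 numeral_2_eq_2)
  have C12: "\<delta> * C 1 \<le> C 2" using C_step(1)[of 1] assms by (simp add: numeral_2_eq_2)
  have s: "(\<Sum>j\<in>{1..<3}. C j) = C 1 + C 2"
    by (simp add: numeral_3_eq_3 numeral_2_eq_2)
  have V: "(c - (C 1 + C 2)) / C 3 * opt (C 3) - M \<le> f (P c)"
    using f_reach_greedy[of 3 c] assms C2 C_1_pos unfolding s by simp
  \<comment> \<open>The first two phases take at most \<open>(1 + 1 / \<delta>) * C 2\<close> of the
    capacity \<open>x * C 2\<close>, and the rest is compared with the budget \<open>C 3\<close>, at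
    most \<open>\<delta> * C 2\<close>.\<close>
  have "(x - 1 - 1 / \<delta>) / \<delta> * G - M \<le> (c - (C 1 + C 2)) / C 3 * opt (C 3) - M"
  proof -
    have "C 3 > 0" using assms c by simp
    have "C 1 \<le> C 2 / \<delta>" using C12 scale_delta_gt_1 by (simp add: field_simps)
    then have "x * C 2 - C 2 / \<delta> - C 2 \<le> c - (C 1 + C 2)" using cx by simp
    then have "(x - 1 - 1 / \<delta>) * C 2 \<le> c - (C 1 + C 2)" by (simp add: algebra_simps)
    have "(x - 1 - 1 / \<delta>) / \<delta> = ((x - 1 - 1 / \<delta>) * C 2) / (\<delta> * C 2)" using C2 by simp
    also have "\<dots> \<le> (c - (C 1 + C 2)) / (\<delta> * C 2)"
      using \<open>(x - 1 - 1 / \<delta>) * C 2 \<le> c - (C 1 + C 2)\<close> C2 scale_delta_gt_1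
      by (intro divide_right_mono) auto
    also have "\<dots> \<le> (c - (C 1 + C 2)) / C 3"
      using assms C3 \<open>C 3 > 0\<close> C2 scale_delta_gt_1 by (intro divide_left_mono) auto
    finally have "(x - 1 - 1 / \<delta>) / \<delta> * G \<le> (c - (C 1 + C 2)) / C 3 * G"
      using G0 by (intro mult_right_mono) auto
    also have "\<dots> \<le> (c - (C 1 + C 2)) / C 3 * opt (C 3)"
      using opt_mono[of c "C 3"] c assms \<open>C 3 > 0\<close> unfolding G_def by (intro mult_left_mono) auto
    finally show ?thesis by simp
  qed
  with V have V: "(x - 1 - 1 / \<delta>) / \<delta> * G - M \<le> f (P c)" by linarith
  have M: "M \<le> \<rho>\<^sup>2 / \<Lambda>\<^sup>2" using rho_ge(3) l by (simp add: field_simps)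
  have "\<rho>\<^sup>2 \<le> \<rho> * F" unfolding power2_eq_square using F r by (intro mult_left_mono) auto
  then have "\<rho>\<^sup>2 / \<Lambda>\<^sup>2 \<le> G / \<Lambda>\<^sup>2" using G by (intro divide_right_mono) auto
  then have M': "M \<le> G / \<Lambda>\<^sup>2" using M by simp
  \<comment> \<open>The growth bound read backwards: raising the optimum from \<open>F\<close> to
    \<open>\<rho> * F\<close> needs a budget ratio of at least \<open>\<rho> * F / (F + M)\<close>.
    The inequalities \<open>\<Lambda>\<^sup>2 * M \<le> \<rho> * F\<close> and
    \<open>\<Lambda> \<le> \<rho>\<close> turn this into a constant.\<close>
  have "\<Lambda>\<^sup>2 / (\<Lambda> + 1) \<le> x"
  proof -
    have "\<rho> * F \<le> x * (F + M)"
      using opt_growth[of "C 2" c] C2 assms C_1_pos G unfolding G_def F_def x_def by simp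
    then have x1: "\<rho> * F / (F + M) \<le> x" using r M_ge_1 by (simp add: field_simps)
    have "\<Lambda>\<^sup>2 * (F + M) \<le> \<Lambda>\<^sup>2 * F + \<rho> * F" using rho_ge(3) \<open>\<rho>\<^sup>2 \<le> \<rho> * F\<close> by (simp add: distrib_left)
    also have "\<dots> \<le> (\<Lambda> * \<rho>) * F + \<rho> * F"
      using rho_ge(1) l r unfolding power2_eq_square by (intro add_right_mono mult_right_mono mult_left_mono) auto
    finally have "\<Lambda>\<^sup>2 * (F + M) \<le> \<rho> * F * (\<Lambda> + 1)" by (simp add: algebra_simps)
    then have "\<Lambda>\<^sup>2 / (\<Lambda> + 1) \<le> \<rho> * F / (F + M)" using r M_ge_1 l by (simp add: field_simps)
    then show ?thesis using x1 by simp
  qed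
  then have "(\<Lambda>\<^sup>2 / (\<Lambda> + 1) - 1 - 1 / \<delta>) / \<delta> - 1 / \<Lambda>\<^sup>2 \<le> (x - 1 - 1 / \<delta>) / \<delta> - 1 / \<Lambda>\<^sup>2"
    using scale_delta_gt_1 by (intro diff_right_mono divide_right_mono) auto
  then have "1 / \<Lambda> \<le> (x - 1 - 1 / \<delta>) / \<delta> - 1 / \<Lambda>\<^sup>2" unfolding scale_lambda_equation .
  moreover have "1 / \<rho> \<le> 1 / \<Lambda>" using rho_ge(1) l by (intro divide_left_mono) auto
  ultimately have "1 / \<rho> * G \<le> ((x - 1 - 1 / \<delta>) / \<delta> - 1 / \<Lambda>\<^sup>2) * G"
    using G0 by (intro mult_right_mono) auto
  also have "\<dots> = (x - 1 - 1 / \<delta>) / \<delta> * G - G / \<Lambda>\<^sup>2" by (simp add: left_diff_distrib)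
  also have "\<dots> \<le> f (P c)" using V M' by simp
  finally show ?thesis using r by (simp add: G_def field_simps)
qed

text \<open>Once phase \<open>i\<close> is complete, either minimality of the next budget or
  \<open>scale_delta_lambda\<close> bounds the optimum by \<open>\<rho> * opt (C i)\<close>. While
  it is incomplete, its greedy part is already large, since the earlier phases cost at most half of
  \<open>C i\<close>.\<close>

lemma phase_ge_3:
  assumes "3 \<le> i" "i < N" "C i \<le> c" "c < C (Suc i)"
  shows "opt c \<le> \<rho> * f (P c)"
proof -
  define F where "F = opt (C i)"
  define s where "s = (\<Sum>j\<in>{1..<i}. C j)"
  define x where "x = c / C i"
  have i: "1 \<le> i" "i \<le> N" using assms by auto
  have Ci: "C i > 0" using C_pos i assms by simp
  have c: "c > 0" using Ci assms by simp
  have cx: "c = x * C i" using Ci by (simp add: x_def)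
  have x1: "x \<ge> 1" using Ci assms by (simp add: x_def)
  have l: "\<Lambda> > 3" using scale_lambda_bounds by simp
  have l2: "\<Lambda>\<^sup>2 \<ge> 3.29235\<^sup>2" using scale_lambda_bounds by (intro power_mono) auto
  have MF: "\<Lambda>\<^sup>2 * M \<le> F" using rho_ge(3) opt_C_ge_3[OF assms(1,2)] by (simp add: F_def)
  have "0 < \<Lambda>\<^sup>2 * M" using l M_ge_1 by simp
  then have F0: "F > 0" using MF by linarith
  have MF': "M \<le> F / \<Lambda>\<^sup>2" using MF l by (simp add: field_simps)
  have "10 * M \<le> \<Lambda>\<^sup>2 * M" using l2 M_ge_1 by (intro mult_right_mono) (auto simp: power2_eq_square)
  then have M10: "10 * M \<le> F" using MF by simp
  have s0: "s \<ge> 0" unfolding s_def using C_pos assms by (intro sum_nonneg) (auto intro: less_imp_le)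
  have "2 * s \<le> (\<delta> - 1) * s" using scale_delta_bounds s0 by (intro mult_right_mono) auto
  then have s: "2 * s \<le> C i" using sum_C[of i] i assms by (simp add: s_def)
  have growth: "opt c \<le> x * (F + M)" using opt_growth[of "C i" c] Ci assms by (simp add: x_def F_def)
  show ?thesis
  proof (cases "s + C i \<le> c")
    case True
    have "F \<le> f (P c)" using f_reach_done[of i c] i True by (simp add: F_def s_def)
    moreover have "opt c \<le> \<rho> * F"
    proof (cases "\<delta> * C i \<le> c")
      case True
      then show ?thesis using opt_lt[of i c] i assms by (simp add: F_def)
    next
      case False
      then have "x \<le> \<delta>" using Ci by (simp add: x_def pos_divide_le_eq)
      have "opt c \<le> \<delta> * (F + F / \<Lambda>\<^sup>2)"
        using \<open>x \<le> \<delta>\<close> x1 MF' F0 M_ge_1 by (intro order_trans[OF growth] mult_mono) auto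
      also have "\<dots> = (\<delta> * (1 + 1 / \<Lambda>\<^sup>2)) * F" by (simp add: algebra_simps)
      also have "\<dots> = \<Lambda> * F" unfolding scale_delta_lambda ..
      also have "\<dots> \<le> \<rho> * F" using rho_ge F0 by (intro mult_right_mono) auto
      finally show ?thesis .
    qed
    moreover have "\<rho> * F \<le> \<rho> * f (P c)" using calculation(1) rho_ge by (intro mult_left_mono) auto
    ultimately show ?thesis by linarith
  next
    case False
    have "(c - s) / C i * F - M \<le> f (P c)"
      using f_reach_greedy[of i c] assms i False s s0 Ci unfolding s_def F_def by simp
    moreover have "(x - 1/2) * F \<le> (c - s) / C i * F"
    proof (rule mult_right_mono)
      show "x - 1/2 \<le> (c - s) / C i" unfolding cx using s Ci by (simp add: field_simps)
    qed (use F0 in simp)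
    \<comment> \<open>As \<open>\<Lambda>\<^sup>2\<close> exceeds 10, \<open>M\<close> is at most a
      tenth of \<open>F\<close>. It remains to compare \<open>11/10 * x\<close> with
      \<open>x - 6/10\<close>: for \<open>x \<ge> 1\<close> the factor 3.2, which is below
      \<Lambda>, is enough.\<close>
    ultimately have "(x - 1/2) * F - F / 10 \<le> f (P c)" using M10 by linarith
    then have "(x - 6/10) * F \<le> f (P c)" by (simp add: algebra_simps)
    have "opt c \<le> x * (11/10 * F)"
      using M10 x1 by (intro order_trans[OF growth] mult_left_mono) auto
    also have "\<dots> = (11/10 * x) * F" by simp
    also have "\<dots> \<le> (3.2 * (x - 6/10)) * F" using x1 F0 by (intro mult_right_mono) auto
    also have "\<dots> = 3.2 * ((x - 6/10) * F)" by (rule mult.assoc)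
    also have "\<dots> \<le> 3.2 * f (P c)"
      using \<open>(x - 6/10) * F \<le> f (P c)\<close> by (rule mult_left_mono) simp
    also have "\<dots> \<le> \<rho> * f (P c)"
      using rho_ge(1) scale_lambda_bounds f_prefix_nonneg by (intro mult_right_mono) auto
    finally show ?thesis .
  qed
qed

lemma order_competitive: "competitive E w f \<rho> order"
  unfolding competitive_def
proof (intro allI impI)
  fix c :: real assume c: "c > 0"
  note X = S_facts[OF c]
  show "opt c \<le> \<rho> * f (P c)"
  proof (cases "c < C 1 \<or> sum w E \<le> c")
    case True
    then show ?thesis
    proof
      assume "c < C 1"
      have "S c = {}"
      proof (rule ccontr)
        assume "S c \<noteq> {}"
        then obtain e where e: "e \<in> S c" by blast
        then have "w e \<le> sum w (S c)" using weight_mono[of "{e}" "S c"] X(1) by simp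
        then show False using C_1_le[of e] e X \<open>c < C 1\<close> by auto
      qed
      then show ?thesis using X(3) f_empty rho_ge f_prefix_nonneg by simp
    next
      assume le: "sum w E \<le> c"
      have "set order \<subseteq> prefix_within w (order @ []) c"
        using order_ordering w_pos le by (intro prefix_within_superset) (auto simp: is_ordering_def)
      then have "P c = E" using order_ordering prefix_subset by (auto simp: is_ordering_def)
      have "opt c \<le> 1 * f E" using X f_mono[of "S c" E] by simp
      also have "\<dots> \<le> \<rho> * f E" using rho_ge f_nonneg by (intro mult_right_mono) auto
      finally show ?thesis using \<open>P c = E\<close> by simp
    qed
  next
    case False
    define I where "I = {i. 1 \<le> i \<and> i < N \<and> C i \<le> c}"
    have fin: "finite I" by (simp add: I_def)
    have "1 \<in> I" using False N_ge_2 by (simp add: I_def)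
    then have "I \<noteq> {}" by blast
    define i where "i = Max I"
    have i: "1 \<le> i" "i < N" "C i \<le> c" using Max_in[OF fin \<open>I \<noteq> {}\<close>] by (auto simp: I_def i_def)
    have "Suc i \<notin> I"
    proof
      assume "Suc i \<in> I"
      then have "Suc i \<le> i" using Max_ge[OF fin, of "Suc i"] by (simp only: i_def)
      then show False by simp
    qed
    \<comment> \<open>For \<open>Suc i < N\<close> this is maximality of \<open>i\<close>; for
      \<open>Suc i = N\<close> the budget is the total weight, which exceeds \<open>c\<close> in
      this case.\<close>
    then have Si: "c < C (Suc i)" using i False C_N by (cases "Suc i = N") (auto simp: I_def)
    consider "i = 1" | "i = 2" "c < C 1 + C 2" | "i = 2" "C 1 + C 2 \<le> c" | "3 \<le> i" using i by linarith
    then show ?thesis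
    proof cases
      case 1
      then show ?thesis using phase_1 i Si by (simp add: numeral_2_eq_2)
    next
      case 2
      then show ?thesis using phase_2_incomplete i by simp
    next
      case 3
      then show ?thesis using phase_2_complete i Si by (simp add: numeral_3_eq_3 numeral_2_eq_2)
    next
      case 4
      then show ?thesis using phase_ge_3 i Si by simp
    qed
  qed
qed

end

theorem theorem2:
  fixes E :: "'a set" and w :: "'a \<Rightarrow> real" and f :: "'a set \<Rightarrow> real" and M :: real
    and S :: "real \<Rightarrow> 'a set" and \<gamma> :: "'a set \<Rightarrow> 'a \<Rightarrow> real" and \<pi> :: "'a list"
  assumes "finite E"
    and "\<And>e. e \<in> E \<Longrightarrow> w e > 0"
    and "M \<ge> 1"
    and "\<And>A. A \<subseteq> E \<Longrightarrow> f A \<ge> 0"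
    and "monotone_obj E f"
    and "bounded_obj M E f"
    and "fractionally_subadditive E f"
    and "\<And>C. C > 0 \<Longrightarrow> optimal_set E w f C (S C)"
    and "\<And>X. X \<subseteq> E \<Longrightarrow> lp_optimal E f X (\<gamma> X)"
    and "alg_scale E w f M S \<gamma> \<pi>"
  shows "is_ordering E \<pi> \<and> competitive E w f (scale_rho M) \<pi>"
proof -
  interpret knapsack_instance E w f M S \<gamma> using assms(1-9) by unfold_locales
  show ?thesis
  proof (cases "E = {}")
    case True
    then have "\<pi> = []" using assms(10) by (simp add: alg_scale_def)
    moreover have "opt c = 0" if "c > 0" for c using S_facts[OF that] f_empty True by simp
    ultimately show ?thesis using True f_empty
      by (simp add: is_ordering_def competitive_def prefix_within_def)
  next
    case False
    then obtain N C xs rest where run: "scale_budgets E w f M N C"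
      "\<forall>i\<in>{1..N}. phase_list w f (S (C i)) (\<gamma> (S (C i))) i (xs i)"
      "is_ordering (E - set (foldl append_new [] (map xs [1..<Suc N]))) rest"
      "\<pi> = foldl append_new [] (map xs [1..<Suc N]) @ rest"
      using assms(10) unfolding alg_scale_def Let_def by (simp only: if_False) blast
    interpret scale_run E w f M S \<gamma> N C xs rest
      using run False by unfold_locales auto
    have "\<pi> = order" using run(4) by (simp only: order_def)
    then show ?thesis using order_ordering order_competitive by simp
  qed
qed

end
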